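(* Let $f\in C^2(\mathbb{R}^n,\mathbb{R})$ and $F_1,F_2\in C^2(\mathbb{R}^n,\mathbb{R}^\kappa)$ be the defining functions of MPCC, and let $\mathcal{S}_t$, with feasible set $M^{\mathcal{S}}_t$, be its Scholtes regularization with parameter $t>0$. Suppose a sequence of nondegenerate Karush-Kuhn-Tucker points $x^t\in M^{\mathcal{S}}_t$ of $\mathcal{S}_t$, all with quadratic index $q$, converges to $\bar x$ for $t\to 0$ (i.e. along some sequence of positive parameters $t$ tending to $0$). If $\bar x\in M$ is a nondegenerate C-stationary point of MPCC with multipliers $(\bar\sigma,\bar\varrho)$, then its C-index $CI$ satisfies $$\max\Big\{q-\big|\{j\in a_{01}(\bar x)\mid \bar\sigma_{1,j}=0\}\big|-\big|\{j\in a_{10}(\bar x)\mid \bar\sigma_{2,j}=0\}\big|,\,0\Big\}\le CI\le q.$$ If additionally NDC4 holds at $\bar x$, then the indices coincide, i.e. $CI=q$.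
   Context: **MPCC.** $\min_x f(x)$ s.t. $x\in M$, where $M=\{x\in\mathbb{R}^n\mid F_{1,j}(x)F_{2,j}(x)=0,\ F_{1,j}(x)\ge 0,\ F_{2,j}(x)\ge 0,\ j=1,\dots,\kappa\}$. $D$ and $D^2$ denote differential and Hessian. For $\bar x\in M$ put $a_{01}(\bar x)=\{j\mid F_{1,j}(\bar x)=0,F_{2,j}(\bar x)>0\}$, $a_{10}(\bar x)=\{j\mid F_{1,j}(\bar x)>0,F_{2,j}(\bar x)=0\}$, $a_{00}(\bar x)=\{j\mid F_{1,j}(\bar x)=0,F_{2,j}(\bar x)=0\}$. **C-stationarity.** $\bar x\in M$ is C-stationary with multipliers $(\bar\sigma,\bar\varrho)$, consisting of $\bar\sigma_{1,j}$ ($j\in a_{01}(\bar x)$), $\bar\sigma_{2,j}$ ($j\in a_{10}(\bar x)$), $\bar\varrho_{1,j},\bar\varrho_{2,j}$ ($j\in a_{00}(\bar x)$), if $$Df(\bar x)=\sum_{j\in a_{01}(\bar x)}\bar\sigma_{1,j}DF_{1,j}(\bar x)+\sum_{j\in a_{10}(\bar x)}\bar\sigma_{2,j}DF_{2,j}(\bar x)+\sum_{j\in a_{00}(\bar x)}\big(\bar\varrho_{1,j}DF_{1,j}(\bar x)+\bar\varrho_{2,j}DF_{2,j}(\bar x)\big)$$ and $\bar\varrho_{1,j}\bar\varrho_{2,j}\ge 0$ for all $j\in a_{00}(\bar x)$. The Lagrange function is $$L(x)=f(x)-\sum_{j\in a_{01}(\bar x)}\bar\sigma_{1,j}F_{1,j}(x)-\sum_{j\in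 a_{10}(\bar x)}\bar\sigma_{2,j}F_{2,j}(x)-\sum_{j\in a_{00}(\bar x)}\big(\bar\varrho_{1,j}F_{1,j}(x)+\bar\varrho_{2,j}F_{2,j}(x)\big),$$ and the tangent space is $\mathcal{T}_{\bar x}=\{\xi\in\mathbb{R}^n\mid DF_{1,j}(\bar x)\xi=0,\ j\in a_{01}(\bar x)\cup a_{00}(\bar x);\ DF_{2,j}(\bar x)\xi=0,\ j\in a_{10}(\bar x)\cup a_{00}(\bar x)\}$. A C-stationary point $\bar x$ with multipliers $(\bar\sigma,\bar\varrho)$ is **nondegenerate** if - NDC1: MPCC-LICQ holds, i.e. the vectors $DF_{1,j}(\bar x)$, $j\in a_{01}(\bar x)\cup a_{00}(\bar x)$, $DF_{2,j}(\bar x)$, $j\in a_{10}(\bar x)\cup a_{00}(\bar x)$, are linearly independent (so the multipliers are unique); - NDC2: $\bar\varrho_{1,j}\bar\varrho_{2,j}>0$ for all $j\in a_{00}(\bar x)$; - NDC3: the restricted Hessian $D^2L(\bar x)\restriction_{\mathcal{T}_{\bar x}}$ is nonsingular. Additional condition NDC4: $\bar\sigma_{1,j}\ne0$ for all $j\in a_{01}(\bar x)$ and $\bar\sigma_{2,j}\neq 0$ for all $j\in a_{10}(\bar x)$. **C-index** of a nondegenerate C-stationary point: $CI=QI+BI$, where $QI$ is the number of negative eigenvalues of $D^2L(\bar x)\restriction_{\mathcal{T}_{\bar x}}$ and $BI$ is the number of $j\in a_{00}(\bar x)$ with $\bar\varrho_{1,j},\bar\varrho_{2,j}<0$. **Scholtes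 regularization** $\mathcal{S}_t$, $t>0$: $\min_x f(x)$ s.t. $x\in M^{\mathcal{S}}_t=\{x\in\mathbb{R}^n\mid F_{1,j}(x)F_{2,j}(x)\le t,\ F_{1,j}(x)\ge0,\ F_{2,j}(x)\ge0,\ j=1,\dots,\kappa\}$. Active index sets: $\mathcal{H}(x)=\{j\mid F_{1,j}(x)F_{2,j}(x)=t\}$, $\mathcal{N}_1(x)=\{j\mid F_{1,j}(x)=0\}$, $\mathcal{N}_2(x)=\{j\mid F_{2,j}(x)=0\}$. A point $x\in M^{\mathcal{S}}_t$ is a **Karush-Kuhn-Tucker point** with multipliers $(\eta,\nu)$ if $$Df(x)=-\sum_{j=1}^\kappa\eta_j\big(F_{2,j}(x)DF_{1,j}(x)+F_{1,j}(x)DF_{2,j}(x)\big)+\sum_{j=1}^\kappa\nu_{1,j}DF_{1,j}(x)+\sum_{j=1}^\kappa\nu_{2,j}DF_{2,j}(x),$$ with $\eta_j,\nu_{1,j},\nu_{2,j}\ge0$, $\eta_j(t-F_{1,j}(x)F_{2,j}(x))=0$, $\nu_{1,j}F_{1,j}(x)=0$, $\nu_{2,j}F_{2,j}(x)=0$ for all $j$. Its Lagrange function is $L^{\mathcal{S}}(x)=f(x)-\sum_j\eta_j(t-F_{1,j}(x)F_{2,j}(x))-\sum_j\nu_{1,j}F_{1,j}(x)-\sum_j\nu_{2,j}F_{2,j}(x)$ (multipliers fixed), and $\mathcal{T}^{\mathcal{S}}_x=\{\xi\mid (F_{2,j}(x)DF_{1,j}(x)+F_{1,j}(x)DF_{2,j}(x))\xi=0,\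 j\in\mathcal{H}(x);\ DF_{1,j}(x)\xi=0,\ j\in\mathcal{N}_1(x);\ DF_{2,j}(x)\xi=0,\ j\in\mathcal{N}_2(x)\}$. It is **nondegenerate** if - ND1 (LICQ): the vectors $F_{2,j}(x)DF_{1,j}(x)+F_{1,j}(x)DF_{2,j}(x)$, $j\in\mathcal{H}(x)$, $DF_{1,j}(x)$, $j\in\mathcal{N}_1(x)$, $DF_{2,j}(x)$, $j\in\mathcal{N}_2(x)$, are linearly independent; - ND2: $\eta_j>0$ for $j\in\mathcal{H}(x)$, $\nu_{1,j}>0$ for $j\in\mathcal{N}_1(x)$, $\nu_{2,j}>0$ for $j\in\mathcal{N}_2(x)$; - ND3: $D^2L^{\mathcal{S}}(x)\restriction_{\mathcal{T}^{\mathcal{S}}_x}$ is nonsingular. Its **quadratic index** is the number of negative eigenvalues of $D^2L^{\mathcal{S}}(x)\restriction_{\mathcal{T}^{\mathcal{S}}_x}$. *)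

theory Defs
  imports "HOL-Analysis.Analysis"
begin

section \<open>Gradients, Hessians, and functions of class C2\<close>

definition grad :: "(real ^ 'n \<Rightarrow> real) \<Rightarrow> real ^ 'n \<Rightarrow> real ^ 'n" where
  "grad f x = (\<chi> i. frechet_derivative f (at x) (axis i 1))"

lemma has_derivative_grad:
  fixes f :: "real ^ 'n \<Rightarrow> real"
  assumes "f differentiable at x"
  shows "(f has_derivative (\<lambda>\<xi>. grad f x \<bullet> \<xi>)) (at x)"
proof -
  have D: "(f has_derivative frechet_derivative f (at x)) (at x)"
    using assms frechet_derivative_works by blast
  then interpret linear "frechet_derivative f (at x)"
    by (rule has_derivative_linear)
  have "frechet_derivative f (at x) \<xi> = grad f x \<bullet> \<xi>" for \<xi>
  proof -
    have "frechet_derivative f (at x) \<xi>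
        = frechet_derivative f (at x) (\<Sum>i\<in>UNIV. \<xi> $ i *\<^sub>R axis i 1)"
      using basis_expansion[of \<xi>] by (simp add: scalar_mult_eq_scaleR)
    also have "\<dots> = grad f x \<bullet> \<xi>"
      by (simp add: sum scale grad_def inner_vec_def mult.commute)
    finally show ?thesis .
  qed
  then show ?thesis
    using D by (metis (no_types, lifting) ext)
qed

definition hessian :: "(real ^ 'n \<Rightarrow> real) \<Rightarrow> real ^ 'n \<Rightarrow> real ^ 'n ^ 'n" where
  "hessian f x = jacobian (grad f) (at x)"

definition C2 :: "(real ^ 'n \<Rightarrow> real) \<Rightarrow> bool" where
  "C2 f \<longleftrightarrow> f differentiable_on UNIV \<and> grad f differentiable_on UNIV
     \<and> continuous_on UNIV (hessian f)"

definition C2_vec :: "(real ^ 'n \<Rightarrow> real ^ 'k) \<Rightarrow> bool" where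
  "C2_vec F \<longleftrightarrow> (\<forall>j. C2 (\<lambda>x. F x $ j))"

abbreviation Dcomp :: "(real ^ 'n \<Rightarrow> real ^ 'k) \<Rightarrow> 'k \<Rightarrow> real ^ 'n \<Rightarrow> real ^ 'n" where
  "Dcomp F j x \<equiv> grad (\<lambda>y. F y $ j) x"


section \<open>Linear algebra\<close>

text \<open>Linear independence of an indexed family; a repeated vector makes it dependent.\<close>
definition lin_indep_family :: "'i set \<Rightarrow> ('i \<Rightarrow> real ^ 'n) \<Rightarrow> bool" where
  "lin_indep_family I v \<longleftrightarrow> inj_on v I \<and> independent (v ` I)"

text \<open>The restriction of a symmetric matrix A to a subspace T is the bilinear form
  of A on T, identified with a self-adjoint operator on T via the inner product that T
  inherits. Thus \<open>\<xi>\<close> in T satisfies the eigenvector equation for \<open>\<lambda>\<close> iff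
  \<open>A \<xi> - \<lambda> \<xi>\<close> is orthogonal to T. With an orthonormal basis of T as the columns of V, this
  is the eigenvalue problem of the matrix \<open>V\<^sup>T A V\<close>.\<close>
definition restr_eigenspace ::
    "real ^ 'n ^ 'n \<Rightarrow> (real ^ 'n) set \<Rightarrow> real \<Rightarrow> (real ^ 'n) set" where
  "restr_eigenspace A T l = {\<xi> \<in> T. \<forall>\<zeta>\<in>T. (A *v \<xi>) \<bullet> \<zeta> = l * (\<xi> \<bullet> \<zeta>)}"

definition restr_eigenvalue :: "real ^ 'n ^ 'n \<Rightarrow> (real ^ 'n) set \<Rightarrow> real \<Rightarrow> bool" where
  "restr_eigenvalue A T l \<longleftrightarrow> (\<exists>\<xi>\<in>restr_eigenspace A T l. \<xi> \<noteq> 0)"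

definition restr_nonsingular :: "real ^ 'n ^ 'n \<Rightarrow> (real ^ 'n) set \<Rightarrow> bool" where
  "restr_nonsingular A T \<longleftrightarrow> (\<forall>\<xi>\<in>T. (\<forall>\<zeta>\<in>T. (A *v \<xi>) \<bullet> \<zeta> = 0) \<longrightarrow> \<xi> = 0)"

text \<open>Eigenvalues are counted with multiplicity. For symmetric A the index set of the sum
  is finite, by the lemma that follows.\<close>
definition num_neg_eigenvalues :: "real ^ 'n ^ 'n \<Rightarrow> (real ^ 'n) set \<Rightarrow> nat" where
  "num_neg_eigenvalues A T =
     (\<Sum>l | l < 0 \<and> restr_eigenvalue A T l. dim (restr_eigenspace A T l))"

lemma finite_restr_eigenvalues:
  fixes A :: "real ^ 'n ^ 'n"
  assumes sym: "transpose A = A"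
  shows "finite {l. restr_eigenvalue A T l}"
proof -
  define v where "v l = (SOME \<xi>. \<xi> \<in> restr_eigenspace A T l \<and> \<xi> \<noteq> 0)" for l
  let ?E = "{l. restr_eigenvalue A T l}"
  have v: "v l \<in> restr_eigenspace A T l \<and> v l \<noteq> 0" if "l \<in> ?E" for l
    unfolding v_def using that someI_ex[of "\<lambda>\<xi>. \<xi> \<in> restr_eigenspace A T l \<and> \<xi> \<noteq> 0"]
    by (auto simp: restr_eigenvalue_def)
  have orth: "v l \<bullet> v m = 0" if "l \<in> ?E" "m \<in> ?E" "l \<noteq> m" for l m
  proof -
    have "l * (v l \<bullet> v m) = (A *v v l) \<bullet> v m"
      using v[OF that(1)] v[OF that(2)] by (auto simp: restr_eigenspace_def)
    also have "\<dots> = v l \<bullet> (A *v v m)"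
      using dot_lmul_matrix[of "v l" A "v m"] sym
      by (metis transpose_matrix_vector)
    also have "\<dots> = m * (v l \<bullet> v m)"
      using v[OF that(1)] v[OF that(2)]
      by (auto simp: restr_eigenspace_def inner_commute)
    finally show ?thesis
      using that(3) by simp
  qed
  have inj: "inj_on v ?E"
  proof (rule inj_onI)
    fix l m assume lm: "l \<in> ?E" "m \<in> ?E" "v l = v m"
    show "l = m"
      using orth[OF lm(1,2)] v[OF lm(2)] lm(3) by (metis inner_eq_zero_iff)
  qed
  have "pairwise orthogonal (v ` ?E)"
    unfolding pairwise_def using orth by (auto simp: orthogonal_def)
  moreover have "0 \<notin> v ` ?E"
    using v by force
  ultimately have "finite (v ` ?E)"
    using pairwise_orthogonal_independent independent_imp_finite by blast
  then show ?thesis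
    using inj finite_imageD by blast
qed


section \<open>MPCC\<close>

text \<open>Multipliers are total functions on the index type, but are only used on the index
  sets on which they are meant to be defined.\<close>

definition feas_MPCC :: "(real ^ 'n \<Rightarrow> real ^ 'k) \<Rightarrow> (real ^ 'n \<Rightarrow> real ^ 'k) \<Rightarrow> (real ^ 'n) set" where
  "feas_MPCC F1 F2 = {x. \<forall>j. F1 x $ j * F2 x $ j = 0 \<and> F1 x $ j \<ge> 0 \<and> F2 x $ j \<ge> 0}"

definition a01 :: "(real ^ 'n \<Rightarrow> real ^ 'k) \<Rightarrow> (real ^ 'n \<Rightarrow> real ^ 'k) \<Rightarrow> real ^ 'n \<Rightarrow> 'k set" where
  "a01 F1 F2 x = {j. F1 x $ j = 0 \<and> F2 x $ j > 0}"

definition a10 :: "(real ^ 'n \<Rightarrow> real ^ 'k) \<Rightarrow> (real ^ 'n \<Rightarrow> real ^ 'k) \<Rightarrow> real ^ 'n \<Rightarrow> 'k set" where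
  "a10 F1 F2 x = {j. F1 x $ j > 0 \<and> F2 x $ j = 0}"

definition a00 :: "(real ^ 'n \<Rightarrow> real ^ 'k) \<Rightarrow> (real ^ 'n \<Rightarrow> real ^ 'k) \<Rightarrow> real ^ 'n \<Rightarrow> 'k set" where
  "a00 F1 F2 x = {j. F1 x $ j = 0 \<and> F2 x $ j = 0}"

definition C_stationary ::
    "(real ^ 'n \<Rightarrow> real) \<Rightarrow> (real ^ 'n \<Rightarrow> real ^ 'k) \<Rightarrow> (real ^ 'n \<Rightarrow> real ^ 'k) \<Rightarrow> real ^ 'n
      \<Rightarrow> ('k \<Rightarrow> real) \<Rightarrow> ('k \<Rightarrow> real) \<Rightarrow> ('k \<Rightarrow> real) \<Rightarrow> ('k \<Rightarrow> real) \<Rightarrow> bool" where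
  "C_stationary f F1 F2 x \<sigma>1 \<sigma>2 \<rho>1 \<rho>2 \<longleftrightarrow>
     x \<in> feas_MPCC F1 F2
     \<and> grad f x = (\<Sum>j\<in>a01 F1 F2 x. \<sigma>1 j *\<^sub>R Dcomp F1 j x)
                + (\<Sum>j\<in>a10 F1 F2 x. \<sigma>2 j *\<^sub>R Dcomp F2 j x)
                + (\<Sum>j\<in>a00 F1 F2 x. \<rho>1 j *\<^sub>R Dcomp F1 j x + \<rho>2 j *\<^sub>R Dcomp F2 j x)
     \<and> (\<forall>j\<in>a00 F1 F2 x. \<rho>1 j * \<rho>2 j \<ge> 0)"

text \<open>The first point argument \<open>xb\<close> determines the index sets; \<open>x\<close> is the variable of the
  Lagrange function.\<close>
definition lagrange_MPCC ::
    "(real ^ 'n \<Rightarrow> real) \<Rightarrow> (real ^ 'n \<Rightarrow> real ^ 'k) \<Rightarrow> (real ^ 'n \<Rightarrow> real ^ 'k) \<Rightarrow> real ^ 'n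
      \<Rightarrow> ('k \<Rightarrow> real) \<Rightarrow> ('k \<Rightarrow> real) \<Rightarrow> ('k \<Rightarrow> real) \<Rightarrow> ('k \<Rightarrow> real) \<Rightarrow> real ^ 'n \<Rightarrow> real" where
  "lagrange_MPCC f F1 F2 xb \<sigma>1 \<sigma>2 \<rho>1 \<rho>2 x =
     f x - (\<Sum>j\<in>a01 F1 F2 xb. \<sigma>1 j * F1 x $ j)
         - (\<Sum>j\<in>a10 F1 F2 xb. \<sigma>2 j * F2 x $ j)
         - (\<Sum>j\<in>a00 F1 F2 xb. \<rho>1 j * F1 x $ j + \<rho>2 j * F2 x $ j)"

definition tangent_MPCC ::
    "(real ^ 'n \<Rightarrow> real ^ 'k) \<Rightarrow> (real ^ 'n \<Rightarrow> real ^ 'k) \<Rightarrow> real ^ 'n \<Rightarrow> (real ^ 'n) set" where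
  "tangent_MPCC F1 F2 x =
     {\<xi>. (\<forall>j \<in> a01 F1 F2 x \<union> a00 F1 F2 x. Dcomp F1 j x \<bullet> \<xi> = 0)
       \<and> (\<forall>j \<in> a10 F1 F2 x \<union> a00 F1 F2 x. Dcomp F2 j x \<bullet> \<xi> = 0)}"

definition MPCC_LICQ ::
    "(real ^ 'n \<Rightarrow> real ^ 'k) \<Rightarrow> (real ^ 'n \<Rightarrow> real ^ 'k) \<Rightarrow> real ^ 'n \<Rightarrow> bool" where
  "MPCC_LICQ F1 F2 x \<longleftrightarrow>
     lin_indep_family
       ((a01 F1 F2 x \<union> a00 F1 F2 x) <+> (a10 F1 F2 x \<union> a00 F1 F2 x))
       (case_sum (\<lambda>j. Dcomp F1 j x) (\<lambda>j. Dcomp F2 j x))"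

definition nondegenerate_C_stationary ::
    "(real ^ 'n \<Rightarrow> real) \<Rightarrow> (real ^ 'n \<Rightarrow> real ^ 'k) \<Rightarrow> (real ^ 'n \<Rightarrow> real ^ 'k) \<Rightarrow> real ^ 'n
      \<Rightarrow> ('k \<Rightarrow> real) \<Rightarrow> ('k \<Rightarrow> real) \<Rightarrow> ('k \<Rightarrow> real) \<Rightarrow> ('k \<Rightarrow> real) \<Rightarrow> bool" where
  "nondegenerate_C_stationary f F1 F2 x \<sigma>1 \<sigma>2 \<rho>1 \<rho>2 \<longleftrightarrow>
     C_stationary f F1 F2 x \<sigma>1 \<sigma>2 \<rho>1 \<rho>2
     \<and> MPCC_LICQ F1 F2 x
     \<and> (\<forall>j\<in>a00 F1 F2 x. \<rho>1 j * \<rho>2 j > 0)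
     \<and> restr_nonsingular (hessian (lagrange_MPCC f F1 F2 x \<sigma>1 \<sigma>2 \<rho>1 \<rho>2) x)
         (tangent_MPCC F1 F2 x)"

definition NDC4 ::
    "(real ^ 'n \<Rightarrow> real ^ 'k) \<Rightarrow> (real ^ 'n \<Rightarrow> real ^ 'k) \<Rightarrow> real ^ 'n
      \<Rightarrow> ('k \<Rightarrow> real) \<Rightarrow> ('k \<Rightarrow> real) \<Rightarrow> bool" where
  "NDC4 F1 F2 x \<sigma>1 \<sigma>2 \<longleftrightarrow>
     (\<forall>j\<in>a01 F1 F2 x. \<sigma>1 j \<noteq> 0) \<and> (\<forall>j\<in>a10 F1 F2 x. \<sigma>2 j \<noteq> 0)"

definition QI_MPCC ::
    "(real ^ 'n \<Rightarrow> real) \<Rightarrow> (real ^ 'n \<Rightarrow> real ^ 'k) \<Rightarrow> (real ^ 'n \<Rightarrow> real ^ 'k) \<Rightarrow> real ^ 'n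
      \<Rightarrow> ('k \<Rightarrow> real) \<Rightarrow> ('k \<Rightarrow> real) \<Rightarrow> ('k \<Rightarrow> real) \<Rightarrow> ('k \<Rightarrow> real) \<Rightarrow> nat" where
  "QI_MPCC f F1 F2 x \<sigma>1 \<sigma>2 \<rho>1 \<rho>2 =
     num_neg_eigenvalues (hessian (lagrange_MPCC f F1 F2 x \<sigma>1 \<sigma>2 \<rho>1 \<rho>2) x)
       (tangent_MPCC F1 F2 x)"

definition BI_MPCC ::
    "(real ^ 'n \<Rightarrow> real ^ 'k) \<Rightarrow> (real ^ 'n \<Rightarrow> real ^ 'k) \<Rightarrow> real ^ 'n
      \<Rightarrow> ('k \<Rightarrow> real) \<Rightarrow> ('k \<Rightarrow> real) \<Rightarrow> nat" where
  "BI_MPCC F1 F2 x \<rho>1 \<rho>2 = card {j \<in> a00 F1 F2 x. \<rho>1 j < 0 \<and> \<rho>2 j < 0}"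

definition C_index ::
    "(real ^ 'n \<Rightarrow> real) \<Rightarrow> (real ^ 'n \<Rightarrow> real ^ 'k) \<Rightarrow> (real ^ 'n \<Rightarrow> real ^ 'k) \<Rightarrow> real ^ 'n
      \<Rightarrow> ('k \<Rightarrow> real) \<Rightarrow> ('k \<Rightarrow> real) \<Rightarrow> ('k \<Rightarrow> real) \<Rightarrow> ('k \<Rightarrow> real) \<Rightarrow> nat" where
  "C_index f F1 F2 x \<sigma>1 \<sigma>2 \<rho>1 \<rho>2 =
     QI_MPCC f F1 F2 x \<sigma>1 \<sigma>2 \<rho>1 \<rho>2 + BI_MPCC F1 F2 x \<rho>1 \<rho>2"


section \<open>Scholtes regularization\<close>

definition feas_Scholtes ::
    "(real ^ 'n \<Rightarrow> real ^ 'k) \<Rightarrow> (real ^ 'n \<Rightarrow> real ^ 'k) \<Rightarrow> real \<Rightarrow> (real ^ 'n) set" where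
  "feas_Scholtes F1 F2 t = {x. \<forall>j. F1 x $ j * F2 x $ j \<le> t \<and> F1 x $ j \<ge> 0 \<and> F2 x $ j \<ge> 0}"

definition act_H ::
    "(real ^ 'n \<Rightarrow> real ^ 'k) \<Rightarrow> (real ^ 'n \<Rightarrow> real ^ 'k) \<Rightarrow> real \<Rightarrow> real ^ 'n \<Rightarrow> 'k set" where
  "act_H F1 F2 t x = {j. F1 x $ j * F2 x $ j = t}"

text \<open>The two remaining active index sets are \<open>act_N F1 x\<close> and \<open>act_N F2 x\<close>.\<close>
definition act_N :: "(real ^ 'n \<Rightarrow> real ^ 'k) \<Rightarrow> real ^ 'n \<Rightarrow> 'k set" where
  "act_N F x = {j. F x $ j = 0}"

definition DH ::
    "(real ^ 'n \<Rightarrow> real ^ 'k) \<Rightarrow> (real ^ 'n \<Rightarrow> real ^ 'k) \<Rightarrow> 'k \<Rightarrow> real ^ 'n \<Rightarrow> real ^ 'n" where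
  "DH F1 F2 j x = F2 x $ j *\<^sub>R Dcomp F1 j x + F1 x $ j *\<^sub>R Dcomp F2 j x"

definition KKT_Scholtes ::
    "(real ^ 'n \<Rightarrow> real) \<Rightarrow> (real ^ 'n \<Rightarrow> real ^ 'k) \<Rightarrow> (real ^ 'n \<Rightarrow> real ^ 'k) \<Rightarrow> real \<Rightarrow> real ^ 'n
      \<Rightarrow> ('k \<Rightarrow> real) \<Rightarrow> ('k \<Rightarrow> real) \<Rightarrow> ('k \<Rightarrow> real) \<Rightarrow> bool" where
  "KKT_Scholtes f F1 F2 t x \<eta> \<nu>1 \<nu>2 \<longleftrightarrow>
     x \<in> feas_Scholtes F1 F2 t
     \<and> grad f x = - (\<Sum>j\<in>UNIV. \<eta> j *\<^sub>R DH F1 F2 j x)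
                + (\<Sum>j\<in>UNIV. \<nu>1 j *\<^sub>R Dcomp F1 j x)
                + (\<Sum>j\<in>UNIV. \<nu>2 j *\<^sub>R Dcomp F2 j x)
     \<and> (\<forall>j. \<eta> j \<ge> 0 \<and> \<nu>1 j \<ge> 0 \<and> \<nu>2 j \<ge> 0
          \<and> \<eta> j * (t - F1 x $ j * F2 x $ j) = 0
          \<and> \<nu>1 j * F1 x $ j = 0 \<and> \<nu>2 j * F2 x $ j = 0)"

definition lagrange_Scholtes ::
    "(real ^ 'n \<Rightarrow> real) \<Rightarrow> (real ^ 'n \<Rightarrow> real ^ 'k) \<Rightarrow> (real ^ 'n \<Rightarrow> real ^ 'k) \<Rightarrow> real
      \<Rightarrow> ('k \<Rightarrow> real) \<Rightarrow> ('k \<Rightarrow> real) \<Rightarrow> ('k \<Rightarrow> real) \<Rightarrow> real ^ 'n \<Rightarrow> real" where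
  "lagrange_Scholtes f F1 F2 t \<eta> \<nu>1 \<nu>2 x =
     f x - (\<Sum>j\<in>UNIV. \<eta> j * (t - F1 x $ j * F2 x $ j))
         - (\<Sum>j\<in>UNIV. \<nu>1 j * F1 x $ j) - (\<Sum>j\<in>UNIV. \<nu>2 j * F2 x $ j)"

definition tangent_Scholtes ::
    "(real ^ 'n \<Rightarrow> real ^ 'k) \<Rightarrow> (real ^ 'n \<Rightarrow> real ^ 'k) \<Rightarrow> real \<Rightarrow> real ^ 'n \<Rightarrow> (real ^ 'n) set" where
  "tangent_Scholtes F1 F2 t x =
     {\<xi>. (\<forall>j \<in> act_H F1 F2 t x. DH F1 F2 j x \<bullet> \<xi> = 0)
       \<and> (\<forall>j \<in> act_N F1 x. Dcomp F1 j x \<bullet> \<xi> = 0)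
       \<and> (\<forall>j \<in> act_N F2 x. Dcomp F2 j x \<bullet> \<xi> = 0)}"

definition LICQ_Scholtes ::
    "(real ^ 'n \<Rightarrow> real ^ 'k) \<Rightarrow> (real ^ 'n \<Rightarrow> real ^ 'k) \<Rightarrow> real \<Rightarrow> real ^ 'n \<Rightarrow> bool" where
  "LICQ_Scholtes F1 F2 t x \<longleftrightarrow>
     lin_indep_family (act_H F1 F2 t x <+> (act_N F1 x <+> act_N F2 x))
       (case_sum (\<lambda>j. DH F1 F2 j x)
         (case_sum (\<lambda>j. Dcomp F1 j x) (\<lambda>j. Dcomp F2 j x)))"

definition nondegenerate_KKT_Scholtes ::
    "(real ^ 'n \<Rightarrow> real) \<Rightarrow> (real ^ 'n \<Rightarrow> real ^ 'k) \<Rightarrow> (real ^ 'n \<Rightarrow> real ^ 'k) \<Rightarrow> real \<Rightarrow> real ^ 'n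
      \<Rightarrow> ('k \<Rightarrow> real) \<Rightarrow> ('k \<Rightarrow> real) \<Rightarrow> ('k \<Rightarrow> real) \<Rightarrow> bool" where
  "nondegenerate_KKT_Scholtes f F1 F2 t x \<eta> \<nu>1 \<nu>2 \<longleftrightarrow>
     KKT_Scholtes f F1 F2 t x \<eta> \<nu>1 \<nu>2
     \<and> LICQ_Scholtes F1 F2 t x
     \<and> (\<forall>j\<in>act_H F1 F2 t x. \<eta> j > 0)
     \<and> (\<forall>j\<in>act_N F1 x. \<nu>1 j > 0)
     \<and> (\<forall>j\<in>act_N F2 x. \<nu>2 j > 0)
     \<and> restr_nonsingular (hessian (lagrange_Scholtes f F1 F2 t \<eta> \<nu>1 \<nu>2) x)
         (tangent_Scholtes F1 F2 t x)"

definition QI_Scholtes ::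
    "(real ^ 'n \<Rightarrow> real) \<Rightarrow> (real ^ 'n \<Rightarrow> real ^ 'k) \<Rightarrow> (real ^ 'n \<Rightarrow> real ^ 'k) \<Rightarrow> real \<Rightarrow> real ^ 'n
      \<Rightarrow> ('k \<Rightarrow> real) \<Rightarrow> ('k \<Rightarrow> real) \<Rightarrow> ('k \<Rightarrow> real) \<Rightarrow> nat" where
  "QI_Scholtes f F1 F2 t x \<eta> \<nu>1 \<nu>2 =
     num_neg_eigenvalues (hessian (lagrange_Scholtes f F1 F2 t \<eta> \<nu>1 \<nu>2) x)
       (tangent_Scholtes F1 F2 t x)"

end

theory Submission
  imports Defs
begin

text \<open>
  Write \<open>\<alpha>\<^sub>1 = \<nu>\<^sub>1 - \<eta> F\<^sub>2\<close> and \<open>\<alpha>\<^sub>2 = \<nu>\<^sub>2 - \<eta> F\<^sub>1\<close> for the total weights of \<open>DF\<^sub>1\<close> and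
  \<open>DF\<^sub>2\<close> in the Karush-Kuhn-Tucker condition at \<open>x\<close>. For an index in \<open>a\<^sub>0\<^sub>1\<close> the limit point
  has a multiplier for \<open>DF\<^sub>1\<close> only. However, near the limit \<open>\<alpha>\<^sub>2 = (F\<^sub>1/F\<^sub>2) \<alpha>\<^sub>1\<close> there whenever the
  product constraint is active, so the unwanted gradient is absorbed by the tilted gradient
  \<open>DF\<^sub>1 + (F\<^sub>1/F\<^sub>2) DF\<^sub>2\<close>, which still tends to \<open>DF\<^sub>1\<close> at the limit. Stationarity then expresses
  \<open>Df\<close> through vectors that converge to the linearly independent family of MPCC-LICQ, and hence
  \<open>\<alpha>\<^sub>1, \<alpha>\<^sub>2\<close> converge to the multipliers of the C-stationary point
  (\<open>lin_indep_coefficients_converge\<close>, \<open>mult2_lim\<close>). Their signs decide which constraints are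
  active near the limit (\<open>settled_ev\<close>): at a biactive index both \<open>F\<^sub>1\<close> and \<open>F\<^sub>2\<close> vanish if the
  multipliers are positive, and only the product constraint is active if they are negative; an
  index of \<open>a\<^sub>0\<^sub>1\<close> or \<open>a\<^sub>1\<^sub>0\<close> can be inactive only if its multiplier vanishes.

  The Hessian form of the Scholtes Lagrange function in direction \<open>\<xi>\<close> is the Hessian form of the
  MPCC Lagrange function with weights \<open>\<alpha>\<close>, plus \<open>2 \<eta>\<^sub>j (DF\<^sub>1\<^sub>j \<xi>) (DF\<^sub>2\<^sub>j \<xi>)\<close> for each \<open>j\<close>. Along tangent
  directions these coupling terms tend to \<open>0\<close>, except at the negative biactive indices. There the
  tangency condition turns the term into \<open>-2 \<eta>\<^sub>j (F\<^sub>1\<^sub>j/F\<^sub>2\<^sub>j) (DF\<^sub>2\<^sub>j \<xi>)\<^sup>2\<close>, whose factor tends to \<open>-\<infinity>\<close>.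
  So each such index replaces two linear tangency conditions by one and makes the freed direction
  strongly negative: it contributes exactly one negative eigenvalue, which is the biactive part of
  the C-index. An inactive index of \<open>a\<^sub>0\<^sub>1\<close> or \<open>a\<^sub>1\<^sub>0\<close> frees a direction about whose curvature nothing
  is known, which accounts for the gap between the two bounds.

  Both bounds are proved by contradiction and compactness. If a bound fails, counting linear
  conditions (\<open>exists_unit_orthogonal\<close>) yields at every late \<open>x\<close> a unit tangent vector on which the
  Scholtes form has one sign, although it is orthogonal to all eigenvectors of that sign of the
  limiting form. A limit of these vectors lies in the MPCC tangent space
  (\<open>nonneg_direction_limit\<close>, \<open>nonpos_direction_limit\<close>), where the limiting form has the opposite
  strict sign on it.
\<close>

section \<open>Eigenvalues of a quadratic form on a subspace\<close>

lemma linear_coeff_zero: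
  fixes b c :: real
  assumes "\<And>s. 0 \<le> s * (2 * b) + s\<^sup>2 * c"
  shows "b = 0"
proof (rule ccontr)
  assume "b \<noteq> 0"
  define k where "k = \<bar>c\<bar> + 1"
  have k: "k > 0" "c < k" by (auto simp: k_def)
  \<comment> \<open>the minimizer of \<open>2 b s + k s\<^sup>2\<close>, with \<open>k > c\<close> to stay positive\<close>
  have "0 \<le> (- b / k) * (2 * b) + (- b / k)\<^sup>2 * c" by (rule assms)
  also have "\<dots> = b\<^sup>2 / k\<^sup>2 * (c - 2 * k)"
    using k by (simp add: field_simps power2_eq_square)
  also have "\<dots> < 0"
    using \<open>b \<noteq> 0\<close> k by (intro mult_pos_neg) auto
  finally show False by simp
qed

text \<open>A maximizer of the Rayleigh quotient on the unit sphere of \<open>T\<close> is an eigenvector, because the first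
  variation of \<open>l \<xi> \<bullet> \<xi> - (A \<xi>) \<bullet> \<xi>\<close>, which is nonnegative on \<open>T\<close>, vanishes at it.\<close>
lemma restr_eigenvector_exists:
  fixes A :: "real ^ 'n ^ 'n"
  assumes sym: "\<And>\<xi> \<zeta>. (A *v \<xi>) \<bullet> \<zeta> = (A *v \<zeta>) \<bullet> \<xi>"
    and T: "subspace T" "T \<noteq> {0}"
  shows "\<exists>l v. v \<in> restr_eigenspace A T l \<and> norm v = 1"
proof -
  let ?q = "\<lambda>w. (A *v w) \<bullet> w"
  have unit: "(1 / norm u) *\<^sub>R u \<in> T \<inter> sphere 0 1" if "u \<in> T" "u \<noteq> 0" for u
    using that T subspace_mul by auto
  have "compact (T \<inter> sphere 0 1)"
    using closed_subspace[OF T(1)] by (simp add: closed_Int_compact)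
  moreover have "T \<inter> sphere 0 1 \<noteq> {}"
    using T unit subspace_0 by blast
  moreover have "continuous_on (T \<inter> sphere 0 1) ?q"
    by (intro continuous_intros)
  ultimately have "\<exists>v\<in>T \<inter> sphere 0 1. \<forall>w\<in>T \<inter> sphere 0 1. ?q w \<le> ?q v"
    by (rule continuous_attains_sup)
  then obtain v where v: "v \<in> T" "norm v = 1"
    and max: "\<And>w. w \<in> T \<Longrightarrow> norm w = 1 \<Longrightarrow> ?q w \<le> ?q v"
    by (metis IntD1 IntD2 IntI mem_sphere_0)
  define l where "l = ?q v"
  have le: "?q w \<le> l * (w \<bullet> w)" if "w \<in> T" for w
  proof (cases "w = 0")
    case False
    let ?u = "(1 / norm w) *\<^sub>R w"
    have "?u \<in> T" "norm ?u = 1"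
      using unit[OF that False] by (simp_all only: Int_iff mem_sphere_0)
    then have "?q ?u \<le> l"
      unfolding l_def by (rule max)
    moreover have "?q ?u = ?q w / (w \<bullet> w)"
      by (simp add: matrix_vector_mult_scaleR flip: power2_norm_eq_inner power2_eq_square)
    ultimately have "?q w / (w \<bullet> w) \<le> l" by linarith
    then show ?thesis
      using False by (simp add: divide_le_eq)
  qed simp
  have "(A *v v) \<bullet> \<zeta> = l * (v \<bullet> \<zeta>)" if "\<zeta> \<in> T" for \<zeta>
  proof -
    have "l * (v \<bullet> \<zeta>) - (A *v v) \<bullet> \<zeta> = 0"
    proof (rule linear_coeff_zero)
      fix s :: real
      let ?w = "v + s *\<^sub>R \<zeta>"
      have "?w \<in> T"
        using that v T by (intro subspace_add subspace_mul) auto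
      then have "0 \<le> l * (?w \<bullet> ?w) - ?q ?w"
        using le by simp
      also have "\<dots> = l * (v \<bullet> v) - ?q v + s * (2 * (l * (v \<bullet> \<zeta>) - (A *v v) \<bullet> \<zeta>))
          + s\<^sup>2 * (l * (\<zeta> \<bullet> \<zeta>) - ?q \<zeta>)"
        using sym[of \<zeta> v]
        by (simp add: matrix_vector_right_distrib matrix_vector_mult_scaleR inner_add_left
            inner_add_right inner_commute[of \<zeta> v] algebra_simps power2_eq_square)
      also have "l * (v \<bullet> v) - ?q v = 0"
        using v by (simp add: l_def flip: power2_norm_eq_inner)
      finally show "0 \<le> s * (2 * (l * (v \<bullet> \<zeta>) - (A *v v) \<bullet> \<zeta>)) + s\<^sup>2 * (l * (\<zeta> \<bullet> \<zeta>) - ?q \<zeta>)"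
        by simp
    qed
    then show ?thesis by simp
  qed
  then show ?thesis
    using v unfolding restr_eigenspace_def by auto
qed

text \<open>The spectral theorem on a subspace: split off one eigenvector \<open>v\<close> and continue in \<open>T \<inter> v\<^sup>\<bottom>\<close>.
  An eigenvector relative to the smaller space is one relative to \<open>T\<close>, since symmetry makes its image
  orthogonal to \<open>v\<close>.\<close>
lemma restr_eigenbasis_exists:
  fixes A :: "real ^ 'n ^ 'n"
  assumes sym: "\<And>\<xi> \<zeta>. (A *v \<xi>) \<bullet> \<zeta> = (A *v \<zeta>) \<bullet> \<xi>"
    and T: "subspace T"
  shows "\<exists>B. finite B \<and> pairwise orthogonal B \<and> (\<forall>b\<in>B. norm b = 1) \<and> span B = T
     \<and> (\<forall>b\<in>B. \<exists>l. b \<in> restr_eigenspace A T l)"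
  using T
proof (induction "dim T" arbitrary: T rule: less_induct)
  case less
  show ?case
  proof (cases "T = {0}")
    case True
    then show ?thesis by (intro exI[of _ "{}"]) auto
  next
    case False
    then obtain l v where v: "v \<in> restr_eigenspace A T l" "norm v = 1"
      using restr_eigenvector_exists[OF sym less.prems] by blast
    have vT: "v \<in> T" using v by (auto simp: restr_eigenspace_def)
    have vv: "v \<bullet> v = 1" using v by (simp flip: power2_norm_eq_inner)
    define T' where "T' = T \<inter> {y. v \<bullet> y = 0}"
    have T': "subspace T'"
      unfolding T'_def using less.prems subspace_hyperplane by (rule subspace_inter)
    have "v \<notin> T'" by (simp add: T'_def vv)
    moreover have "T' \<subseteq> T" by (simp add: T'_def)
    ultimately have "T' \<subset> T" using vT by blast
    then have "dim T' < dim T"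
      using T' less.prems by (metis dim_psubset span_eq_iff)
    then obtain B where B: "finite B" "pairwise orthogonal B" "\<forall>b\<in>B. norm b = 1" "span B = T'"
      "\<forall>b\<in>B. \<exists>l. b \<in> restr_eigenspace A T' l"
      using less.hyps T' by blast
    have BT': "B \<subseteq> T'" using B(4) span_superset by blast
    have dec: "\<zeta> - (v \<bullet> \<zeta>) *\<^sub>R v \<in> T'" if "\<zeta> \<in> T" for \<zeta>
      using that vT less.prems by (auto simp: T'_def inner_diff_right vv subspace_diff subspace_mul)
    have eig: "b \<in> restr_eigenspace A T m" if b: "b \<in> restr_eigenspace A T' m" for b m
    proof -
      have bT: "b \<in> T" and bv: "v \<bullet> b = 0"
        using b by (auto simp: restr_eigenspace_def T'_def)
      have Abv: "(A *v b) \<bullet> v = 0"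
        using v(1) bT bv sym[of b v] by (simp add: restr_eigenspace_def)
      have "(A *v b) \<bullet> \<zeta> = m * (b \<bullet> \<zeta>)" if "\<zeta> \<in> T" for \<zeta>
      proof -
        have "(A *v b) \<bullet> (\<zeta> - (v \<bullet> \<zeta>) *\<^sub>R v) = m * (b \<bullet> (\<zeta> - (v \<bullet> \<zeta>) *\<^sub>R v))"
          using b dec[OF that] by (auto simp: restr_eigenspace_def)
        then show ?thesis
          using bv by (simp add: inner_diff_right Abv inner_commute[of b v])
      qed
      then show ?thesis using bT by (simp add: restr_eigenspace_def)
    qed
    have "span (insert v B) = T"
    proof
      show "span (insert v B) \<subseteq> T"
        using vT BT' less.prems by (intro span_minimal) (auto simp: T'_def)
      show "T \<subseteq> span (insert v B)"
      proof
        fix \<zeta> assume "\<zeta> \<in> T"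
        then have "\<zeta> - (v \<bullet> \<zeta>) *\<^sub>R v \<in> span B" using dec B(4) by simp
        then show "\<zeta> \<in> span (insert v B)"
          using span_breakdown_eq by blast
      qed
    qed
    moreover have "pairwise orthogonal (insert v B)"
      using B(2) BT' by (auto simp: pairwise_insert orthogonal_def T'_def inner_commute)
    moreover have "\<forall>b\<in>insert v B. \<exists>l. b \<in> restr_eigenspace A T l"
      using B(5) v(1) eig by blast
    ultimately show ?thesis
      using B(1,3) v(2) by (intro exI[of _ "insert v B"]) simp
  qed
qed

lemma orthonormal_expansion:
  fixes B :: "(real ^ 'n) set"
  assumes "finite B" "pairwise orthogonal B" "\<forall>b\<in>B. norm b = 1" "\<xi> \<in> span B"
  shows "\<xi> = (\<Sum>b\<in>B. (\<xi> \<bullet> b) *\<^sub>R b)"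
proof -
  obtain u where u: "\<xi> = (\<Sum>b\<in>B. u b *\<^sub>R b)"
    using assms(1,4) by (auto simp: span_finite)
  have "\<xi> \<bullet> b = u b" if "b \<in> B" for b
  proof -
    have "\<xi> \<bullet> b = (\<Sum>c\<in>B. if c = b then u c else 0)"
      unfolding u inner_sum_left
    proof (rule sum.cong)
      fix c assume "c \<in> B"
      then show "(u c *\<^sub>R c) \<bullet> b = (if c = b then u c else 0)"
        using assms(2,3) that
        by (auto simp: pairwise_def orthogonal_def simp flip: power2_norm_eq_inner)
    qed simp
    then show ?thesis using that assms(1) by simp
  qed
  then show ?thesis by (subst u) simp
qed

text \<open>\<open>N\<close> and \<open>P\<close> stand for the orthonormal eigenvectors with negative and with nonnegative eigenvalue. Only
  the signs of the form on the orthogonal complements of \<open>N\<close> and of \<open>P\<close> in \<open>T\<close> are recorded: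
  these are what dimension counting can use, because orthogonality to a finite set costs at most as
  many dimensions as the set has elements.\<close>
definition index_split ::
    "real ^ 'n ^ 'n \<Rightarrow> (real ^ 'n) set \<Rightarrow> (real ^ 'n) set \<Rightarrow> (real ^ 'n) set \<Rightarrow> bool" where
  "index_split A T N P \<longleftrightarrow>
     finite N \<and> finite P \<and> card N = num_neg_eigenvalues A T \<and> card N + card P = dim T
     \<and> (\<forall>\<xi>\<in>T. (\<forall>b\<in>N. b \<bullet> \<xi> = 0) \<longrightarrow> 0 \<le> (A *v \<xi>) \<bullet> \<xi>)
     \<and> (\<forall>\<xi>\<in>T. (\<forall>b\<in>P. b \<bullet> \<xi> = 0) \<longrightarrow> \<xi> \<noteq> 0 \<longrightarrow> (A *v \<xi>) \<bullet> \<xi> < 0)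
     \<and> (restr_nonsingular A T \<longrightarrow>
          (\<forall>\<xi>\<in>T. (\<forall>b\<in>N. b \<bullet> \<xi> = 0) \<longrightarrow> \<xi> \<noteq> 0 \<longrightarrow> 0 < (A *v \<xi>) \<bullet> \<xi>))"

text \<open>In an eigenbasis \<open>B\<close> the form is \<open>\<Sum>b\<in>B. lam b * (\<xi> \<bullet> b)\<^sup>2\<close>. Each eigenspace is spanned by the
  members of \<open>B\<close> with that eigenvalue, so the negative eigenvalues with their multiplicities are
  counted by \<open>{b \<in> B. lam b < 0}\<close>.\<close>
lemma index_split_exists:
  fixes A :: "real ^ 'n ^ 'n"
  assumes sym: "\<And>\<xi> \<zeta>. (A *v \<xi>) \<bullet> \<zeta> = (A *v \<zeta>) \<bullet> \<xi>"
    and T: "subspace T"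
  shows "\<exists>N P. index_split A T N P"
proof -
  obtain B where B: "finite B" "pairwise orthogonal B" "\<forall>b\<in>B. norm b = 1" "span B = T"
      "\<forall>b\<in>B. \<exists>l. b \<in> restr_eigenspace A T l"
    using restr_eigenbasis_exists[OF sym T] by blast
  then obtain lam where lam: "\<And>b. b \<in> B \<Longrightarrow> b \<in> restr_eigenspace A T (lam b)"
    by metis
  note expand = orthonormal_expansion[OF B(1-3), unfolded B(4)]
  have B0: "b \<noteq> 0" if "b \<in> B" for b using B(3) that by auto
  have BT: "B \<subseteq> T" using B(4) span_superset by blast
  have indep: "independent C" if "C \<subseteq> B" for C
    using that B(2) B0 pairwise_orthogonal_independent pairwise_subset by (metis in_mono)
  have form: "(A *v \<xi>) \<bullet> b = lam b * (\<xi> \<bullet> b)" if "\<xi> \<in> T" "b \<in> B" for \<xi> b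
    using lam[OF that(2)] that sym[of \<xi> b] by (auto simp: restr_eigenspace_def inner_commute)
  have quad: "(A *v \<xi>) \<bullet> \<xi> = (\<Sum>b\<in>B. lam b * (\<xi> \<bullet> b)\<^sup>2)" if "\<xi> \<in> T" for \<xi>
  proof -
    have "(A *v \<xi>) \<bullet> \<xi> = (A *v \<xi>) \<bullet> (\<Sum>b\<in>B. (\<xi> \<bullet> b) *\<^sub>R b)"
      using expand[OF that] by simp
    also have "\<dots> = (\<Sum>b\<in>B. lam b * (\<xi> \<bullet> b)\<^sup>2)"
      unfolding inner_sum_right using form[OF that]
      by (intro sum.cong) (auto simp: power2_eq_square)
    finally show ?thesis .
  qed
  have nz: "\<exists>b\<in>B. \<xi> \<bullet> b \<noteq> 0" if "\<xi> \<in> T" "\<xi> \<noteq> 0" for \<xi>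
    using expand[OF that(1)] that(2) by (metis (no_types, lifting) scaleR_zero_left sum.neutral)
  have espace: "restr_eigenspace A T l = span {b\<in>B. lam b = l}" for l
  proof
    show "span {b\<in>B. lam b = l} \<subseteq> restr_eigenspace A T l"
    proof (rule span_minimal)
      show "subspace (restr_eigenspace A T l)"
        using T by (auto simp: restr_eigenspace_def subspace_def inner_add_left
            matrix_vector_right_distrib matrix_vector_mult_scaleR algebra_simps)
    qed (use lam in auto)
    show "restr_eigenspace A T l \<subseteq> span {b\<in>B. lam b = l}"
    proof
      fix \<xi> assume \<xi>: "\<xi> \<in> restr_eigenspace A T l"
      then have \<xi>T: "\<xi> \<in> T" by (simp add: restr_eigenspace_def)
      have "\<xi> \<bullet> b = 0" if "b \<in> B" "lam b \<noteq> l" for b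
        using form[OF \<xi>T that(1)] \<xi> that BT by (auto simp: restr_eigenspace_def)
      then have "(\<xi> \<bullet> b) *\<^sub>R b \<in> span {b\<in>B. lam b = l}" if "b \<in> B" for b
        using that by (cases "lam b = l") (auto intro: span_mul span_base span_zero)
      then show "\<xi> \<in> span {b\<in>B. lam b = l}"
        by (subst expand[OF \<xi>T]) (auto intro: span_sum)
    qed
  qed
  define N where "N = {b\<in>B. lam b < 0}"
  define P where "P = {b\<in>B. lam b \<ge> 0}"
  have "restr_eigenvalue A T l \<longleftrightarrow> l \<in> lam ` B" for l
  proof
    assume "restr_eigenvalue A T l"
    then have "\<not> span {b\<in>B. lam b = l} \<subseteq> {0}"
      unfolding restr_eigenvalue_def espace by blast
    then have "{b\<in>B. lam b = l} \<noteq> {}"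
      using span_empty by (metis order_refl)
    then show "l \<in> lam ` B" by blast
  qed (use lam B0 in \<open>auto simp: restr_eigenvalue_def\<close>)
  then have "{l. l < 0 \<and> restr_eigenvalue A T l} = lam ` N"
    by (auto simp: N_def)
  then have "num_neg_eigenvalues A T = (\<Sum>l\<in>lam ` N. card {b\<in>B. lam b = l})"
    unfolding num_neg_eigenvalues_def espace
    by (simp add: indep dim_eq_card_independent)
  also have "\<dots> = (\<Sum>l\<in>lam ` N. card {b\<in>N. lam b = l})"
    by (intro sum.cong arg_cong[where f = card]) (auto simp: N_def)
  also have "\<dots> = card N"
    using B(1) sum.image_gen[of N "\<lambda>_. 1 :: nat" lam] by (simp add: N_def)
  finally have cardN: "card N = num_neg_eigenvalues A T" by simp
  have "dim T = card B"
    using indep[of B] B(4) dim_span_eq_card_independent by auto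
  moreover have "N \<union> P = B" "N \<inter> P = {}" by (auto simp: N_def P_def)
  ultimately have cardNP: "card N + card P = dim T"
    using B(1) by (metis card_Un_disjoint finite_Un)
  have "index_split A T N P"
    unfolding index_split_def
  proof (intro conjI)
    show "finite N" "finite P" using B(1) by (auto simp: N_def P_def)
    show "card N = num_neg_eigenvalues A T" "card N + card P = dim T"
      by (fact cardN cardNP)+
    have pos: "0 \<le> lam b * (\<xi> \<bullet> b)\<^sup>2" if "b \<in> B" "\<forall>b\<in>N. b \<bullet> \<xi> = 0" for \<xi> b
      using that by (cases "lam b < 0") (auto simp: N_def inner_commute)
    then show "\<forall>\<xi>\<in>T. (\<forall>b\<in>N. b \<bullet> \<xi> = 0) \<longrightarrow> 0 \<le> (A *v \<xi>) \<bullet> \<xi>"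
      using quad by (auto intro: sum_nonneg)
    show "restr_nonsingular A T \<longrightarrow>
       (\<forall>\<xi>\<in>T. (\<forall>b\<in>N. b \<bullet> \<xi> = 0) \<longrightarrow> \<xi> \<noteq> 0 \<longrightarrow> 0 < (A *v \<xi>) \<bullet> \<xi>)"
    proof (intro ballI impI)
      fix \<xi> assume ns: "restr_nonsingular A T" and \<xi>: "\<xi> \<in> T" and N0: "\<forall>b\<in>N. b \<bullet> \<xi> = 0" and "\<xi> \<noteq> 0"
      then obtain b where b: "b \<in> B" "\<xi> \<bullet> b \<noteq> 0" using nz by blast
      then have "\<not> lam b < 0" using N0 by (auto simp: N_def inner_commute)
      moreover have "lam b \<noteq> 0"
        using ns lam[OF b(1)] B0[OF b(1)]
        by (auto simp: restr_nonsingular_def restr_eigenspace_def)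
      ultimately have "0 < lam b * (\<xi> \<bullet> b)\<^sup>2"
        using b(2) by simp
      then show "0 < (A *v \<xi>) \<bullet> \<xi>"
        unfolding quad[OF \<xi>] using B(1) b(1) pos N0 by (intro sum_pos2)
    qed
    show "\<forall>\<xi>\<in>T. (\<forall>b\<in>P. b \<bullet> \<xi> = 0) \<longrightarrow> \<xi> \<noteq> 0 \<longrightarrow> (A *v \<xi>) \<bullet> \<xi> < 0"
    proof (intro ballI impI)
      fix \<xi> assume \<xi>: "\<xi> \<in> T" and P0: "\<forall>b\<in>P. b \<bullet> \<xi> = 0" and "\<xi> \<noteq> 0"
      then obtain b where b: "b \<in> B" "\<xi> \<bullet> b \<noteq> 0" using nz by blast
      then have "lam b < 0" using P0 by (force simp: P_def inner_commute)
      have "0 < (\<Sum>b\<in>B. - (lam b * (\<xi> \<bullet> b)\<^sup>2))"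
      proof (rule sum_pos2[OF B(1) b(1)])
        show "0 < - (lam b * (\<xi> \<bullet> b)\<^sup>2)"
          using b(2) \<open>lam b < 0\<close> by (simp add: mult_neg_pos)
        fix c assume "c \<in> B"
        then show "0 \<le> - (lam c * (\<xi> \<bullet> c)\<^sup>2)"
          using P0 by (cases "lam c \<ge> 0") (auto simp: P_def inner_commute mult_nonpos_nonneg)
      qed
      then show "(A *v \<xi>) \<bullet> \<xi> < 0"
        unfolding quad[OF \<xi>] by (simp add: sum_negf)
    qed
  qed
  then show ?thesis by blast
qed

text \<open>The form in which all dimension counts below are made: fewer linear conditions than dimensions
  leave a nonzero solution.\<close>
lemma exists_unit_orthogonal:
  fixes S :: "(real ^ 'n) set"
  assumes S: "subspace S" and V: "finite V" "card V < dim S"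
  shows "\<exists>\<xi>\<in>S. norm \<xi> = 1 \<and> (\<forall>v\<in>V. v \<bullet> \<xi> = 0)"
proof -
  have "dim (span V) < dim S"
    using V dim_le_card' by (metis dim_span le_less_trans)
  then have "\<exists>\<zeta>. \<zeta> \<in> S \<and> \<zeta> \<noteq> 0 \<and> (\<forall>v\<in>V. v \<bullet> \<zeta> = 0)"
  proof -
    have *: "dim {y. \<forall>x\<in>span V. orthogonal x y} + dim (span V) = CARD('n)"
      using dim_subspace_orthogonal_to_vectors[of "span V" UNIV] by simp
    let ?K = "{y. \<forall>x\<in>span V. orthogonal x y}"
    have K: "subspace ?K"
      by (auto simp: subspace_def orthogonal_clauses)
    have "dim {x + y |x y. x \<in> S \<and> y \<in> ?K} + dim (S \<inter> ?K) = dim S + dim ?K"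
      by (rule dim_sums_Int[OF S K])
    moreover have "dim {x + y |x y. x \<in> S \<and> y \<in> ?K} \<le> CARD('n)"
      using dim_subset_UNIV[of "{x + y |x y. x \<in> S \<and> y \<in> ?K}"] by simp
    ultimately have "dim (S \<inter> ?K) \<noteq> 0"
      using * \<open>dim (span V) < dim S\<close> by linarith
    then have "\<not> S \<inter> ?K \<subseteq> {0}"
      by (simp only: dim_eq_0)  auto
    then show ?thesis
      by (auto simp: orthogonal_def span_base)
  qed
  then obtain \<zeta> where "\<zeta> \<in> S" "\<zeta> \<noteq> 0" "\<forall>v\<in>V. v \<bullet> \<zeta> = 0" by blast
  then show ?thesis
    using S by (intro bexI[of _ "(1 / norm \<zeta>) *\<^sub>R \<zeta>"]) (auto intro: subspace_mul)
qed

section \<open>Second derivatives\<close>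

lemma grad_eqI:
  fixes f :: "real ^ 'n \<Rightarrow> real"
  assumes "(f has_derivative (\<lambda>h. v \<bullet> h)) (at x)"
  shows "grad f x = v"
  unfolding grad_def frechet_derivative_at[OF assms, symmetric]
  by (simp add: vec_eq_iff inner_axis)

lemma hessian_eqI:
  fixes f :: "real ^ 'n \<Rightarrow> real"
  assumes "\<And>y. (f has_derivative (\<lambda>h. g y \<bullet> h)) (at y)"
    and "(g has_derivative g') (at x)"
  shows "hessian f x *v \<xi> = g' \<xi>"
proof -
  have "grad f = g" using assms(1) grad_eqI by blast
  then show ?thesis
    using assms(2) frechet_derivative_at[OF assms(2)] unfolding hessian_def jacobian_def
    by (simp add: has_derivative_linear matrix_works)
qed

lemma C2_has_derivative:
  assumes "C2 f"
  shows "(f has_derivative (\<lambda>h. grad f x \<bullet> h)) (at x)"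
    and "(grad f has_derivative (\<lambda>h. hessian f x *v h)) (at x)"
  using assms by (auto simp: C2_def differentiable_on_def hessian_def
      intro!: has_derivative_grad simp flip: jacobian_works)

lemma C2_vecD: "C2_vec F \<Longrightarrow> C2 (\<lambda>x. F x $ j)"
  by (simp add: C2_vec_def)

text \<open>Two applications of the mean value theorem, first in direction \<open>u\<close> and then in direction \<open>v\<close>.\<close>
lemma second_difference_mean_value:
  fixes f :: "real ^ 'n \<Rightarrow> real"
  assumes f: "C2 f" and h: "h > 0"
  shows "\<exists>y. norm (y - x) \<le> h * (norm u + norm v)
    \<and> f (x + h *\<^sub>R u + h *\<^sub>R v) - f (x + h *\<^sub>R u) - f (x + h *\<^sub>R v) + f x
        = h\<^sup>2 * ((hessian f y *v v) \<bullet> u)"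
proof -
  define p where "p s = f (x + s *\<^sub>R u + h *\<^sub>R v) - f (x + s *\<^sub>R u)" for s
  have f1: "((\<lambda>s. f (a + s *\<^sub>R u)) has_real_derivative grad f (a + s *\<^sub>R u) \<bullet> u) (at s)" for a s
  proof -
    have "((\<lambda>s. a + s *\<^sub>R u) has_derivative (\<lambda>s. s *\<^sub>R u)) (at s)"
      by (auto intro!: derivative_eq_intros)
    from has_derivative_compose[OF this C2_has_derivative(1)[OF f]]
    show ?thesis unfolding has_field_derivative_def
      by (rule has_derivative_eq_rhs) (simp add: fun_eq_iff)
  qed
  have "(p has_real_derivative
      (grad f (x + s *\<^sub>R u + h *\<^sub>R v) - grad f (x + s *\<^sub>R u)) \<bullet> u) (at s)" for s
    unfolding p_def inner_diff_left using f1[of "x + h *\<^sub>R v" s]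
    by (intro DERIV_diff f1) (simp add: add.assoc add.commute[of "h *\<^sub>R v"])
  then obtain a where a: "0 < a" "a < h"
    "p h - p 0 = (h - 0) * ((grad f (x + a *\<^sub>R u + h *\<^sub>R v) - grad f (x + a *\<^sub>R u)) \<bullet> u)"
    using MVT2[OF h, of p "\<lambda>s. (grad f (x + s *\<^sub>R u + h *\<^sub>R v) - grad f (x + s *\<^sub>R u)) \<bullet> u"]
    by auto
  define r where "r s = grad f (x + a *\<^sub>R u + s *\<^sub>R v) \<bullet> u" for s
  have "(r has_real_derivative (hessian f (x + a *\<^sub>R u + s *\<^sub>R v) *v v) \<bullet> u) (at s)" for s
  proof -
    have "((\<lambda>s. x + a *\<^sub>R u + s *\<^sub>R v) has_derivative (\<lambda>s. s *\<^sub>R v)) (at s)"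
      by (auto intro!: derivative_eq_intros)
    from has_derivative_inner_left[OF has_derivative_compose[OF this C2_has_derivative(2)[OF f]], of u]
    show ?thesis
      unfolding has_field_derivative_def r_def[abs_def]
      by (rule has_derivative_eq_rhs) (simp add: fun_eq_iff matrix_vector_mult_scaleR)
  qed
  then obtain b where b: "0 < b" "b < h"
    "r h - r 0 = (h - 0) * ((hessian f (x + a *\<^sub>R u + b *\<^sub>R v) *v v) \<bullet> u)"
    using MVT2[OF h, of r "\<lambda>s. (hessian f (x + a *\<^sub>R u + s *\<^sub>R v) *v v) \<bullet> u"] by auto
  have "norm (x + a *\<^sub>R u + b *\<^sub>R v - x) \<le> a * norm u + b * norm v"
    using a b norm_triangle_ineq[of "a *\<^sub>R u" "b *\<^sub>R v"] by (simp add: add.assoc)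
  also have "\<dots> \<le> h * (norm u + norm v)"
    using a b by (simp add: distrib_left add_mono mult_right_mono)
  finally show ?thesis
    using a(3) b(3)
    by (intro exI[of _ "x + a *\<^sub>R u + b *\<^sub>R v"])
      (simp add: p_def r_def inner_diff_left power2_eq_square)
qed

lemma tendsto_hessian:
  assumes "C2 f" "(y \<longlongrightarrow> z) G" 
  shows "((\<lambda>i. hessian f (y i)) \<longlongrightarrow> hessian f z) G"
  using assms by (auto simp: C2_def continuous_on_eq_continuous_at intro: isCont_tendsto_compose)

lemma tendsto_matrix_vector_mult:
  fixes A :: "'i \<Rightarrow> real ^ 'n ^ 'm"
  assumes "(A \<longlongrightarrow> B) G" "(\<xi> \<longlongrightarrow> \<zeta>) G"
  shows "((\<lambda>i. A i *v \<xi> i) \<longlongrightarrow> B *v \<zeta>) G"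
  by (rule vec_tendstoI)
    (simp add: matrix_vector_mult_def, intro tendsto_sum tendsto_mult tendsto_vec_nth assms)

text \<open>Schwarz's theorem: the second difference divided by \<open>h\<^sup>2\<close> is symmetric in \<open>u\<close> and \<open>v\<close>, and by continuity
  of the Hessian it tends to the Hessian form in either order of the arguments.\<close>
lemma hessian_symmetric:
  fixes f :: "real ^ 'n \<Rightarrow> real"
  assumes f: "C2 f"
  shows "(hessian f x *v u) \<bullet> v = (hessian f x *v v) \<bullet> u"
proof -
  define h where "h n = inverse (real (Suc n))" for n
  define D where "D u v n = (f (x + h n *\<^sub>R u + h n *\<^sub>R v) - f (x + h n *\<^sub>R u)
    - f (x + h n *\<^sub>R v) + f x) / (h n)\<^sup>2" for u v n
  have h: "h n > 0" for n by (simp add: h_def)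
  have lim: "D u v \<longlonglongrightarrow> (hessian f x *v v) \<bullet> u" for u v
  proof -
    obtain y where y: "\<And>n. norm (y n - x) \<le> h n * (norm u + norm v)"
      and D: "\<And>n. D u v n = (hessian f (y n) *v v) \<bullet> u"
    proof -
      have "\<exists>y. norm (y - x) \<le> h n * (norm u + norm v) \<and> D u v n = (hessian f y *v v) \<bullet> u" for n
        using second_difference_mean_value[OF f h[of n], of x u v] h[of n]
        unfolding D_def by (auto simp: field_simps)
      then show ?thesis using that by metis
    qed
    have "(\<lambda>n. h n * (norm u + norm v)) \<longlonglongrightarrow> 0 * (norm u + norm v)"
      unfolding h_def by (intro tendsto_intros LIMSEQ_inverse_real_of_nat)
    then have lim0: "(\<lambda>n. h n * (norm u + norm v)) \<longlonglongrightarrow> 0" by simp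
    have "(\<lambda>n. y n - x) \<longlonglongrightarrow> 0"
      by (rule Lim_null_comparison[OF _ lim0]) (use y in simp)
    then have "y \<longlonglongrightarrow> x"
      by (rule LIM_zero_cancel)
    then have "(\<lambda>n. (hessian f (y n) *v v) \<bullet> u) \<longlonglongrightarrow> (hessian f x *v v) \<bullet> u"
      by (intro tendsto_intros tendsto_matrix_vector_mult tendsto_hessian f)
    then show ?thesis using D by (metis (no_types, lifting) ext)
  qed
  have "D u v = D v u"
    by (auto simp: D_def add.assoc add.commute[of "_ *\<^sub>R u"])
  then show ?thesis
    using lim[of u v] lim[of v u] LIMSEQ_unique by metis
qed

text \<open>Both Lagrange functions have the shape of \<open>L\<close>: the Scholtes one with \<open>e = \<eta>\<close>, the MPCC one with
  \<open>e = 0\<close>. The product terms contribute to the weights of the constraint Hessians, and their mixed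
  first-order part is kept apart in the last sum.\<close>
lemma hessian_lagrangian_form:
  fixes f :: "real ^ 'n \<Rightarrow> real" and F1 F2 :: "real ^ 'n \<Rightarrow> real ^ 'k"
  assumes f: "C2 f" and F1: "C2_vec F1" and F2: "C2_vec F2"
    and L: "\<And>y. L y = f y - (\<Sum>j\<in>UNIV. a j * F1 y $ j) - (\<Sum>j\<in>UNIV. b j * F2 y $ j)
       + (\<Sum>j\<in>UNIV. e j * (F1 y $ j * F2 y $ j)) - k"
  shows "(hessian L y *v \<xi>) \<bullet> \<zeta> = (hessian f y *v \<xi>) \<bullet> \<zeta>
     - (\<Sum>j\<in>UNIV. (a j - e j * F2 y $ j) * ((hessian (\<lambda>y. F1 y $ j) y *v \<xi>) \<bullet> \<zeta>))
     - (\<Sum>j\<in>UNIV. (b j - e j * F1 y $ j) * ((hessian (\<lambda>y. F2 y $ j) y *v \<xi>) \<bullet> \<zeta>))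
     + (\<Sum>j\<in>UNIV. e j * ((Dcomp F1 j y \<bullet> \<xi>) * (Dcomp F2 j y \<bullet> \<zeta>)
                        + (Dcomp F2 j y \<bullet> \<xi>) * (Dcomp F1 j y \<bullet> \<zeta>)))"
proof -
  note d1 = C2_has_derivative(1)[OF C2_vecD[OF F1]] C2_has_derivative(1)[OF C2_vecD[OF F2]]
    C2_has_derivative(1)[OF f]
  note d2 = C2_has_derivative(2)[OF C2_vecD[OF F1]] C2_has_derivative(2)[OF C2_vecD[OF F2]]
    C2_has_derivative(2)[OF f]
  define g where "g y = grad f y - (\<Sum>j\<in>UNIV. a j *\<^sub>R Dcomp F1 j y)
    - (\<Sum>j\<in>UNIV. b j *\<^sub>R Dcomp F2 j y)
    + (\<Sum>j\<in>UNIV. e j *\<^sub>R (F2 y $ j *\<^sub>R Dcomp F1 j y + F1 y $ j *\<^sub>R Dcomp F2 j y))" for y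
  have Lg: "(L has_derivative (\<lambda>h. g y \<bullet> h)) (at y)" for y
  proof -
    have "(L has_derivative (\<lambda>h. grad f y \<bullet> h - (\<Sum>j\<in>UNIV. a j * (Dcomp F1 j y \<bullet> h))
        - (\<Sum>j\<in>UNIV. b j * (Dcomp F2 j y \<bullet> h))
        + (\<Sum>j\<in>UNIV. e j * (F1 y $ j * (Dcomp F2 j y \<bullet> h) + (Dcomp F1 j y \<bullet> h) * F2 y $ j))
        - 0)) (at y)"
      unfolding L[abs_def]
      by (intro has_derivative_diff has_derivative_add has_derivative_sum has_derivative_mult_right
          has_derivative_mult has_derivative_const d1)
    moreover have "grad f y \<bullet> h - (\<Sum>j\<in>UNIV. a j * (Dcomp F1 j y \<bullet> h))
        - (\<Sum>j\<in>UNIV. b j * (Dcomp F2 j y \<bullet> h))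
        + (\<Sum>j\<in>UNIV. e j * (F1 y $ j * (Dcomp F2 j y \<bullet> h) + (Dcomp F1 j y \<bullet> h) * F2 y $ j))
        - 0 = g y \<bullet> h" for h
      by (simp add: g_def inner_diff_left inner_add_left inner_sum_left add.commute mult.commute)
    ultimately show ?thesis by (simp only:)
  qed
  have g': "(g has_derivative (\<lambda>h. hessian f y *v h
     - (\<Sum>j\<in>UNIV. a j *\<^sub>R (hessian (\<lambda>y. F1 y $ j) y *v h))
     - (\<Sum>j\<in>UNIV. b j *\<^sub>R (hessian (\<lambda>y. F2 y $ j) y *v h))
     + (\<Sum>j\<in>UNIV. e j *\<^sub>R ((F2 y $ j *\<^sub>R (hessian (\<lambda>y. F1 y $ j) y *v h)
           + (Dcomp F2 j y \<bullet> h) *\<^sub>R Dcomp F1 j y)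
         + (F1 y $ j *\<^sub>R (hessian (\<lambda>y. F2 y $ j) y *v h)
           + (Dcomp F1 j y \<bullet> h) *\<^sub>R Dcomp F2 j y))))) (at y)"
    unfolding g_def[abs_def]
    by (intro has_derivative_diff has_derivative_add has_derivative_sum has_derivative_scaleR_right
        has_derivative_scaleR d1 d2)
  show ?thesis
    unfolding hessian_eqI[OF Lg g']
    by (simp add: inner_diff_left inner_add_left inner_sum_left algebra_simps sum.distrib
        sum_subtractf)
qed

section \<open>Convergence of the multipliers\<close>

lemma tendsto_C2:
  assumes "C2 f" "(y \<longlongrightarrow> z) G"
  shows "((\<lambda>i. f (y i)) \<longlongrightarrow> f z) G" and "((\<lambda>i. grad f (y i)) \<longlongrightarrow> grad f z) G"
proof -
  have "isCont f z" "isCont (grad f) z"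
    using C2_has_derivative[OF assms(1)] has_derivative_continuous by blast+
  then show "((\<lambda>i. f (y i)) \<longlongrightarrow> f z) G" "((\<lambda>i. grad f (y i)) \<longlongrightarrow> grad f z) G"
    using assms(2) isCont_tendsto_compose by blast+
qed

text \<open>The coefficients are values of the dual functionals, which are bounded.\<close>
lemma lin_indep_coefficients_bounded:
  fixes w :: "'l \<Rightarrow> real ^ 'n"
  assumes I: "finite I" and w: "lin_indep_family I w"
  obtains C where "C > 0" "\<And>e. (\<Sum>l\<in>I. \<bar>e l\<bar>) \<le> C * norm (\<Sum>l\<in>I. e l *\<^sub>R w l)"
proof -
  have inj: "inj_on w I" and ind: "independent (w ` I)"
    using w by (auto simp: lin_indep_family_def)
  have "\<exists>K. \<forall>e. m \<in> I \<longrightarrow> \<bar>e m\<bar> \<le> K * norm (\<Sum>l\<in>I. e l *\<^sub>R w l)" for m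
  proof -
    obtain g :: "real ^ 'n \<Rightarrow> real" where g: "linear g"
      "\<forall>v\<in>w ` I. g v = (if v = w m then 1 else 0)"
      using linear_independent_extend[OF ind, of "\<lambda>v. if v = w m then 1 else 0"] by blast
    obtain K where K: "\<And>v. norm (g v) \<le> K * norm v" using linear_bounded[OF g(1)] by blast
    have "\<bar>e m\<bar> \<le> K * norm (\<Sum>l\<in>I. e l *\<^sub>R w l)" if "m \<in> I" for e
    proof -
      have "g (\<Sum>l\<in>I. e l *\<^sub>R w l) = (\<Sum>l\<in>I. if l = m then e l else 0)"
        unfolding linear_sum[OF g(1)] linear_scale[OF g(1)]
        using g(2) inj that by (intro sum.cong) (auto simp: inj_on_def)
      also have "\<dots> = e m" using that I by simp
      finally show ?thesis using K by (metis real_norm_def)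
    qed
    then show ?thesis by blast
  qed
  then obtain K where K: "\<And>m e. m \<in> I \<Longrightarrow> \<bar>e m\<bar> \<le> K m * norm (\<Sum>l\<in>I. e l *\<^sub>R w l)"
    by metis
  show thesis
  proof
    \<comment> \<open>the summand \<open>1\<close> keeps the constant positive when \<open>I\<close> is empty\<close>
    show "1 + (\<Sum>m\<in>I. \<bar>K m\<bar>) > 0" by (simp add: add_pos_nonneg sum_nonneg)
    fix e :: "'l \<Rightarrow> real"
    let ?s = "norm (\<Sum>l\<in>I. e l *\<^sub>R w l)"
    have "(\<Sum>m\<in>I. \<bar>e m\<bar>) \<le> (\<Sum>m\<in>I. \<bar>K m\<bar> * ?s)"
    proof (rule sum_mono)
      fix m assume "m \<in> I"
      then have "\<bar>e m\<bar> \<le> K m * ?s" by (rule K)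
      also have "\<dots> \<le> \<bar>K m\<bar> * ?s" by (intro mult_right_mono) auto
      finally show "\<bar>e m\<bar> \<le> \<bar>K m\<bar> * ?s" .
    qed
    also have "\<dots> \<le> (1 + (\<Sum>m\<in>I. \<bar>K m\<bar>)) * ?s"
      by (simp add: distrib_right flip: sum_distrib_right)
    finally show "(\<Sum>m\<in>I. \<bar>e m\<bar>) \<le> (1 + (\<Sum>m\<in>I. \<bar>K m\<bar>)) * ?s" .
  qed
qed

text \<open>For late \<open>i\<close> the vectors \<open>W i l\<close> are so close to \<open>w l\<close> that the bound on coefficients with respect
  to \<open>w\<close> persists, with twice the constant, for \<open>W i\<close>.\<close>
lemma lin_indep_coefficients_converge:
  fixes w :: "'l \<Rightarrow> real ^ 'n"
  assumes I: "finite I" and w: "lin_indep_family I w"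
    and W: "\<And>l. l \<in> I \<Longrightarrow> ((\<lambda>i. W i l) \<longlongrightarrow> w l) G"
    and sum: "((\<lambda>i. \<Sum>l\<in>I. a i l *\<^sub>R W i l) \<longlongrightarrow> (\<Sum>l\<in>I. b l *\<^sub>R w l)) G"
    and "l \<in> I"
  shows "((\<lambda>i. a i l) \<longlongrightarrow> b l) G"
proof -
  obtain C where C: "C > 0" "\<And>e. (\<Sum>l\<in>I. \<bar>e l\<bar>) \<le> C * norm (\<Sum>l\<in>I. e l *\<^sub>R w l)"
    using lin_indep_coefficients_bounded[OF I w] by metis
  define e where "e i l = a i l - b l" for i l
  define S where "S i = (\<Sum>l\<in>I. \<bar>e i l\<bar>)" for i
  define d where "d i = (\<Sum>l\<in>I. e i l *\<^sub>R W i l)" for i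
  define m where "m i = (\<Sum>l\<in>I. norm (W i l - w l))" for i
  have "((\<lambda>i. (\<Sum>l\<in>I. a i l *\<^sub>R W i l) - (\<Sum>l\<in>I. b l *\<^sub>R W i l))
      \<longlongrightarrow> (\<Sum>l\<in>I. b l *\<^sub>R w l) - (\<Sum>l\<in>I. b l *\<^sub>R w l)) G"
    by (intro tendsto_diff sum tendsto_sum tendsto_scaleR tendsto_const W)
  then have "(d \<longlongrightarrow> 0) G"
    by (simp add: d_def[abs_def] e_def scaleR_diff_left sum_subtractf)
  then have d0: "((\<lambda>i. 2 * C * norm (d i)) \<longlongrightarrow> 0) G"
    by (intro tendsto_mult_right_zero tendsto_norm_zero)
  have "((\<lambda>i. C * m i) \<longlongrightarrow> C * (\<Sum>l\<in>I. norm (w l - w l))) G"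
    unfolding m_def by (intro tendsto_intros W)
  then have "eventually (\<lambda>i. C * m i < 1 / 2) G"
    by (rule order_tendstoD) simp
  then have "eventually (\<lambda>i. norm (e i l) \<le> 2 * C * norm (d i)) G"
  proof eventually_elim
    case (elim i)
    have S0: "S i \<ge> 0" by (simp add: S_def sum_nonneg)
    have "norm (\<Sum>l\<in>I. e i l *\<^sub>R w l) = norm (d i - (\<Sum>l\<in>I. e i l *\<^sub>R (W i l - w l)))"
      by (simp add: d_def scaleR_diff_right sum_subtractf)
    also have "\<dots> \<le> norm (d i) + (\<Sum>l\<in>I. norm (e i l *\<^sub>R (W i l - w l)))"
      by (rule order_trans[OF norm_triangle_ineq4 add_left_mono[OF norm_sum]])
    also have "\<dots> \<le> norm (d i) + (\<Sum>l\<in>I. S i * norm (W i l - w l))"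
      unfolding S_def using I by (auto intro!: sum_mono mult_right_mono member_le_sum)
    also have "\<dots> = norm (d i) + S i * m i"
      by (simp add: m_def sum_distrib_left)
    finally have "S i \<le> C * (norm (d i) + S i * m i)"
      using C(2)[of "e i"] C(1) unfolding S_def by (meson mult_left_mono less_imp_le order_trans)
    also have "\<dots> \<le> C * norm (d i) + S i * (1 / 2)"
      using mult_left_mono[OF less_imp_le[OF elim] S0] by (simp add: algebra_simps)
    finally have "S i \<le> 2 * C * norm (d i)" by simp
    moreover have "norm (e i l) \<le> S i"
      unfolding S_def using I \<open>l \<in> I\<close> by (auto intro: member_le_sum)
    ultimately show ?case by linarith
  qed
  then have "((\<lambda>i. e i l) \<longlongrightarrow> 0) G"
    using d0 by (rule Lim_null_comparison)
  then show ?thesis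
    unfolding e_def by (rule LIM_zero_cancel)
qed

text \<open>The total weight of the gradient of one component of \<open>F\<^sub>1\<close> (or \<open>F\<^sub>2\<close>) in the Karush-Kuhn-Tucker
  condition; \<open>F\<close> is the other one of the two functions, which enters through the product
  constraint.\<close>
definition eff_mult ::
    "('k \<Rightarrow> real) \<Rightarrow> ('k \<Rightarrow> real) \<Rightarrow> (real ^ 'n \<Rightarrow> real ^ 'k) \<Rightarrow> real ^ 'n \<Rightarrow> 'k \<Rightarrow> real" where
  "eff_mult \<nu> \<eta> F y j = \<nu> j - \<eta> j * F y $ j"

text \<open>The set \<open>J\<close> will be \<open>a01 F1 F2 xb\<close>, where \<open>F\<^sub>1 / F\<^sub>2\<close> is small near \<open>xb\<close>. On other indices, and when the
  product constraint is inactive, the gradient of \<open>F\<^sub>1\<close> is left as it is.\<close>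
definition tilt ::
    "(real ^ 'n \<Rightarrow> real ^ 'k) \<Rightarrow> (real ^ 'n \<Rightarrow> real ^ 'k) \<Rightarrow> real \<Rightarrow> 'k set \<Rightarrow> real ^ 'n \<Rightarrow> 'k \<Rightarrow> real"
  where "tilt F1 F2 t J y j = (if j \<in> J \<inter> act_H F1 F2 t y then F1 y $ j / F2 y $ j else 0)"

definition tilted_grad ::
    "(real ^ 'n \<Rightarrow> real ^ 'k) \<Rightarrow> (real ^ 'n \<Rightarrow> real ^ 'k) \<Rightarrow> real \<Rightarrow> 'k set \<Rightarrow> real ^ 'n \<Rightarrow> 'k \<Rightarrow> real ^ 'n"
  where "tilted_grad F1 F2 t J y j = Dcomp F1 j y + tilt F1 F2 t J y j *\<^sub>R Dcomp F2 j y"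

text \<open>The multipliers of the C-stationary point as a function on all indices: with \<open>A = a01 F1 F2 xb\<close>,
  \<open>B = a00 F1 F2 xb\<close> this is the limit of the weights of the gradients of \<open>F\<^sub>1\<close>; the default value
  \<open>0\<close> belongs to the indices where \<open>F\<^sub>1\<close> is positive at \<open>xb\<close>.\<close>
definition limit_mult :: "'k set \<Rightarrow> 'k set \<Rightarrow> ('k \<Rightarrow> real) \<Rightarrow> ('k \<Rightarrow> real) \<Rightarrow> 'k \<Rightarrow> real" where
  "limit_mult A B \<sigma> \<rho> j = (if j \<in> A then \<sigma> j else if j \<in> B then \<rho> j else 0)"

text \<open>The setting is symmetric in \<open>F\<^sub>1\<close> and \<open>F\<^sub>2\<close>. The following facts transfer each result about \<open>a01\<close> and \<open>F\<^sub>1\<close>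
  to \<open>a10\<close> and \<open>F\<^sub>2\<close>.\<close>
lemma act_H_swap: "act_H F2 F1 = act_H F1 F2"
  by (auto simp: act_H_def mult.commute fun_eq_iff)

lemma DH_swap: "DH F2 F1 = DH F1 F2"
  by (auto simp: DH_def add.commute fun_eq_iff)

lemma a01_swap: "a01 F2 F1 = a10 F1 F2" and a10_swap: "a10 F2 F1 = a01 F1 F2"
  and a00_swap: "a00 F2 F1 = a00 F1 F2"
  by (auto simp: a01_def a10_def a00_def fun_eq_iff)

lemma KKT_swap:
  "KKT_Scholtes f F1 F2 t y \<eta> \<nu>1 \<nu>2 \<Longrightarrow> KKT_Scholtes f F2 F1 t y \<eta> \<nu>2 \<nu>1"
  by (auto simp: KKT_Scholtes_def feas_Scholtes_def DH_swap[of F2 F1] mult.commute)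

lemma C_stationary_swap:
  "C_stationary f F1 F2 y \<sigma>1 \<sigma>2 \<rho>1 \<rho>2 \<Longrightarrow> C_stationary f F2 F1 y \<sigma>2 \<sigma>1 \<rho>2 \<rho>1"
  by (auto simp: C_stationary_def feas_MPCC_def a01_swap[of F2 F1] a10_swap[of F2 F1]
      a00_swap[of F2 F1] mult.commute add_ac)

lemma MPCC_LICQ_swap:
  assumes "MPCC_LICQ F1 F2 y"
  shows "MPCC_LICQ F2 F1 y"
proof -
  let ?I = "(a01 F1 F2 y \<union> a00 F1 F2 y) <+> (a10 F1 F2 y \<union> a00 F1 F2 y)"
  let ?v = "case_sum (\<lambda>j. Dcomp F1 j y) (\<lambda>j. Dcomp F2 j y)"
  define s :: "'b + 'b \<Rightarrow> 'b + 'b" where "s = case_sum Inr Inl"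
  have img: "(a10 F1 F2 y \<union> a00 F1 F2 y) <+> (a01 F1 F2 y \<union> a00 F1 F2 y) = s ` ?I"
    by (simp add: s_def Plus_def image_Un image_image Un_commute)
  have comp: "case_sum (\<lambda>j. Dcomp F2 j y) (\<lambda>j. Dcomp F1 j y) (s l) = ?v l" for l
    by (cases l) (auto simp: s_def)
  have "inj_on ?v ?I" "independent (?v ` ?I)"
    using assms by (auto simp: MPCC_LICQ_def lin_indep_family_def)
  then show ?thesis
    unfolding MPCC_LICQ_def lin_indep_family_def a01_swap[of F2 F1] a10_swap[of F2 F1]
      a00_swap[of F2 F1] img
    by (auto simp: image_image comp inj_on_def)
qed

text \<open>Where \<open>F\<^sub>2 > 0\<close>, complementarity gives \<open>\<nu>\<^sub>2 = 0\<close>, hence \<open>\<alpha>\<^sub>2 = - \<eta> F\<^sub>1\<close>; if the product constraint is active,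
  then also \<open>F\<^sub>1 > 0\<close>, \<open>\<nu>\<^sub>1 = 0\<close> and \<open>\<alpha>\<^sub>1 = - \<eta> F\<^sub>2\<close>.\<close>
lemma KKT_tilt:
  assumes kkt: "KKT_Scholtes f F1 F2 t y \<eta> \<nu>1 \<nu>2" and t: "t > 0"
    and j: "j \<in> J" "F2 y $ j > 0"
  shows "eff_mult \<nu>2 \<eta> F1 y j = tilt F1 F2 t J y j * eff_mult \<nu>1 \<eta> F2 y j"
    and "\<eta> j * tilt F1 F2 t J y j = - eff_mult \<nu>2 \<eta> F1 y j / F2 y $ j"
proof -
  have \<nu>2: "\<nu>2 j = 0" and \<nu>1: "\<nu>1 j = 0 \<or> F1 y $ j = 0"
    and \<eta>: "\<eta> j = 0 \<or> j \<in> act_H F1 F2 t y"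
    using kkt j by (auto simp: KKT_Scholtes_def act_H_def)
  show "eff_mult \<nu>2 \<eta> F1 y j = tilt F1 F2 t J y j * eff_mult \<nu>1 \<eta> F2 y j"
    and "\<eta> j * tilt F1 F2 t J y j = - eff_mult \<nu>2 \<eta> F1 y j / F2 y $ j"
    using \<nu>1 \<nu>2 \<eta> j t by (auto simp: eff_mult_def tilt_def act_H_def field_simps)
qed

lemma KKT_grad:
  assumes "KKT_Scholtes f F1 F2 t y \<eta> \<nu>1 \<nu>2"
  shows "grad f y = (\<Sum>j\<in>UNIV. eff_mult \<nu>1 \<eta> F2 y j *\<^sub>R Dcomp F1 j y
                                + eff_mult \<nu>2 \<eta> F1 y j *\<^sub>R Dcomp F2 j y)"
  using assms
  by (simp add: KKT_Scholtes_def eff_mult_def DH_def algebra_simps sum.distrib sum_subtractf)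

lemma DH_tangent_tilted:
  assumes "DH F1 F2 j y \<bullet> \<xi> = 0" "F2 y $ j > 0" "j \<in> J" "j \<in> act_H F1 F2 t y"
  shows "tilted_grad F1 F2 t J y j \<bullet> \<xi> = 0"
  using assms by (auto simp: DH_def tilted_grad_def tilt_def inner_add_left field_simps)

text \<open>The filter \<open>G\<close> is arbitrary so that the results apply to the given sequence as well as to
  subsequences of it, which are represented by finer filters on the same index type.\<close>
locale scholtes_limit =
  fixes f :: "real ^ 'n \<Rightarrow> real" and F1 F2 :: "real ^ 'n \<Rightarrow> real ^ 'k"
    and G :: "'i filter" and t :: "'i \<Rightarrow> real" and x :: "'i \<Rightarrow> real ^ 'n"
    and \<eta> \<nu>1 \<nu>2 :: "'i \<Rightarrow> 'k \<Rightarrow> real" and xb :: "real ^ 'n" and \<sigma>1 \<sigma>2 \<rho>1 \<rho>2 :: "'k \<Rightarrow> real"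
  assumes f: "C2 f" and F1: "C2_vec F1" and F2: "C2_vec F2"
    and t_pos: "t i > 0"
    and KKT: "KKT_Scholtes f F1 F2 (t i) (x i) (\<eta> i) (\<nu>1 i) (\<nu>2 i)"
    and x_lim: "(x \<longlongrightarrow> xb) G"
    and C_stat: "C_stationary f F1 F2 xb \<sigma>1 \<sigma>2 \<rho>1 \<rho>2"
    and LICQ: "MPCC_LICQ F1 F2 xb"
    and rho_pos: "j \<in> a00 F1 F2 xb \<Longrightarrow> \<rho>1 j * \<rho>2 j > 0"
begin

lemma swap: "scholtes_limit f F2 F1 G t x \<eta> \<nu>2 \<nu>1 xb \<sigma>2 \<sigma>1 \<rho>2 \<rho>1"
proof
  show "\<rho>2 j * \<rho>1 j > 0" if "j \<in> a00 F2 F1 xb" for j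
    using rho_pos that by (simp add: a00_swap[of F2 F1] mult.commute)
qed (rule f F1 F2 t_pos x_lim KKT_swap[OF KKT] C_stationary_swap[OF C_stat]
      MPCC_LICQ_swap[OF LICQ])+

abbreviation "A01 \<equiv> a01 F1 F2 xb"
abbreviation "A10 \<equiv> a10 F1 F2 xb"
abbreviation "A00 \<equiv> a00 F1 F2 xb"
abbreviation "\<alpha>1 i \<equiv> eff_mult (\<nu>1 i) (\<eta> i) F2 (x i)"
abbreviation "\<alpha>2 i \<equiv> eff_mult (\<nu>2 i) (\<eta> i) F1 (x i)"
abbreviation "w1 i \<equiv> tilted_grad F1 F2 (t i) A01 (x i)"
abbreviation "w2 i \<equiv> tilted_grad F2 F1 (t i) A10 (x i)"
abbreviation "s1 \<equiv> limit_mult A01 A00 \<sigma>1 \<rho>1"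
abbreviation "s2 \<equiv> limit_mult A10 A00 \<sigma>2 \<rho>2"

lemma index_cases: "j \<in> A01 \<and> j \<notin> A10 \<and> j \<notin> A00 \<or> j \<in> A10 \<and> j \<notin> A01 \<and> j \<notin> A00
    \<or> j \<in> A00 \<and> j \<notin> A01 \<and> j \<notin> A10"
proof -
  have "F1 xb $ j * F2 xb $ j = 0 \<and> F1 xb $ j \<ge> 0 \<and> F2 xb $ j \<ge> 0"
    using C_stat by (auto simp: C_stationary_def feas_MPCC_def)
  then show ?thesis by (auto simp: a01_def a10_def a00_def)
qed

lemma F1_lim: "((\<lambda>i. F1 (x i) $ j) \<longlongrightarrow> F1 xb $ j) G"
  and F2_lim: "((\<lambda>i. F2 (x i) $ j) \<longlongrightarrow> F2 xb $ j) G"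
  and g1_lim: "((\<lambda>i. Dcomp F1 j (x i)) \<longlongrightarrow> Dcomp F1 j xb) G"
  and g2_lim: "((\<lambda>i. Dcomp F2 j (x i)) \<longlongrightarrow> Dcomp F2 j xb) G"
  using tendsto_C2[OF C2_vecD[OF F1, of j] x_lim] tendsto_C2[OF C2_vecD[OF F2, of j] x_lim]
  by simp_all

lemma F2_pos_ev: "j \<in> A01 \<Longrightarrow> eventually (\<lambda>i. F2 (x i) $ j > 0) G"
  by (rule order_tendstoD[OF F2_lim]) (simp add: a01_def)

lemma tilt_lim: "((\<lambda>i. tilt F1 F2 (t i) A01 (x i) j) \<longlongrightarrow> 0) G"
proof (cases "j \<in> A01")
  case True
  then have "((\<lambda>i. F1 (x i) $ j / F2 (x i) $ j) \<longlongrightarrow> 0 / F2 xb $ j) G"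
    by (intro tendsto_divide F2_lim) (use F1_lim[of j] in \<open>auto simp: a01_def\<close>)
  then have "((\<lambda>i. norm (F1 (x i) $ j / F2 (x i) $ j)) \<longlongrightarrow> 0) G"
    by (intro tendsto_norm_zero) simp
  then show ?thesis
    by (rule Lim_null_comparison[rotated]) (simp add: tilt_def)
qed (simp add: tilt_def)

lemma w1_lim: "((\<lambda>i. w1 i j) \<longlongrightarrow> Dcomp F1 j xb) G"
proof -
  have "((\<lambda>i. w1 i j) \<longlongrightarrow> Dcomp F1 j xb + 0 *\<^sub>R Dcomp F2 j xb) G"
    unfolding tilted_grad_def by (intro tendsto_intros g1_lim g2_lim tilt_lim)
  then show ?thesis by simp
qed

lemma w2_lim: "((\<lambda>i. w2 i j) \<longlongrightarrow> Dcomp F2 j xb) G"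
  using scholtes_limit.w1_lim[OF swap] by (simp only: a01_swap[of F2 F1])

lemma F1_pos_ev: "j \<in> A10 \<Longrightarrow> eventually (\<lambda>i. F1 (x i) $ j > 0) G"
  using scholtes_limit.F2_pos_ev[OF swap, of j] by (simp only: a01_swap[of F2 F1])

text \<open>On \<open>a01\<close> the term \<open>\<alpha>\<^sub>2 DF\<^sub>2\<close> equals \<open>\<alpha>\<^sub>1\<close> times the tilting correction, and symmetrically on \<open>a10\<close>, so
  the sum over all gradients shrinks to the index sets of MPCC-LICQ.\<close>
lemma stationarity_tilted:
  "eventually (\<lambda>i. grad f (x i) = (\<Sum>j\<in>A01 \<union> A00. \<alpha>1 i j *\<^sub>R w1 i j)
      + (\<Sum>j\<in>A10 \<union> A00. \<alpha>2 i j *\<^sub>R w2 i j)) G"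
proof -
  have "eventually (\<lambda>i. (\<forall>j\<in>A01. F2 (x i) $ j > 0) \<and> (\<forall>j\<in>A10. F1 (x i) $ j > 0)) G"
    by (intro eventually_conj eventually_ball_finite ballI F1_pos_ev F2_pos_ev) auto
  then show ?thesis
  proof eventually_elim
    case (elim i)
    have "grad f (x i) = (\<Sum>j\<in>UNIV. (if j \<in> A01 \<union> A00 then \<alpha>1 i j *\<^sub>R w1 i j else 0)
                                  + (if j \<in> A10 \<union> A00 then \<alpha>2 i j *\<^sub>R w2 i j else 0))"
      unfolding KKT_grad[OF KKT]
    proof (rule sum.cong[OF refl])
      fix j
      have 1: "\<alpha>2 i j = tilt F1 F2 (t i) A01 (x i) j * \<alpha>1 i j" if "j \<in> A01"
        using KKT_tilt(1)[OF KKT t_pos that] elim that by blast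
      have 2: "\<alpha>1 i j = tilt F2 F1 (t i) A10 (x i) j * \<alpha>2 i j" if "j \<in> A10"
        using KKT_tilt(1)[OF KKT_swap[OF KKT] t_pos that] elim that by blast
      consider "j \<in> A01" "j \<notin> A10" "j \<notin> A00" | "j \<in> A10" "j \<notin> A01" "j \<notin> A00"
        | "j \<in> A00" "j \<notin> A01" "j \<notin> A10"
        using index_cases by blast
      then show "\<alpha>1 i j *\<^sub>R Dcomp F1 j (x i) + \<alpha>2 i j *\<^sub>R Dcomp F2 j (x i)
          = (if j \<in> A01 \<union> A00 then \<alpha>1 i j *\<^sub>R w1 i j else 0)
            + (if j \<in> A10 \<union> A00 then \<alpha>2 i j *\<^sub>R w2 i j else 0)"
      proof cases
        case a: 1
        then show ?thesis
          by (simp add: tilted_grad_def scaleR_add_right 1[OF a(1)] mult.commute)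
      next
        case b: 2
        then show ?thesis
          by (simp add: tilted_grad_def scaleR_add_right 2[OF b(1)] mult.commute)
      next
        case 3
        then show ?thesis by (simp add: tilted_grad_def tilt_def)
      qed
    qed
    moreover have "(\<Sum>j\<in>UNIV. if j \<in> S then h j else 0) = sum h S"
      for S :: "'k set" and h :: "'k \<Rightarrow> real ^ 'n"
      by (simp add: sum.If_cases)
    ultimately show ?case by (simp only: sum.distrib)
  qed
qed

lemma mult_lim_main:
  shows "j \<in> A01 \<union> A00 \<Longrightarrow> ((\<lambda>i. \<alpha>1 i j) \<longlongrightarrow> s1 j) G"
    and "j \<in> A10 \<union> A00 \<Longrightarrow> ((\<lambda>i. \<alpha>2 i j) \<longlongrightarrow> s2 j) G"
proof -
  let ?I = "(A01 \<union> A00) <+> (A10 \<union> A00)"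
  let ?w = "case_sum (\<lambda>j. Dcomp F1 j xb) (\<lambda>j. Dcomp F2 j xb)"
  let ?W = "\<lambda>i. case_sum (w1 i) (w2 i)"
  let ?a = "\<lambda>i. case_sum (\<alpha>1 i) (\<alpha>2 i)"
  let ?b = "case_sum s1 s2"
  have W: "((\<lambda>i. ?W i l) \<longlongrightarrow> ?w l) G" for l
    by (cases l) (simp_all add: w1_lim w2_lim)
  have "A01 \<inter> A00 = {}" "A10 \<inter> A00 = {}"
    by (auto simp: a01_def a10_def a00_def)
  then have sum_b: "(\<Sum>l\<in>?I. ?b l *\<^sub>R ?w l) = grad f xb"
    using C_stat by (simp add: C_stationary_def sum.Plus sum.union_disjoint sum.distrib add_ac)
      (auto simp: limit_mult_def intro!: arg_cong2[where f = "(+)"] sum.cong)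
  have "eventually (\<lambda>i. grad f (x i) = (\<Sum>l\<in>?I. ?a i l *\<^sub>R ?W i l)) G"
    using stationarity_tilted by eventually_elim (simp add: sum.Plus)
  then have "((\<lambda>i. \<Sum>l\<in>?I. ?a i l *\<^sub>R ?W i l) \<longlongrightarrow> (\<Sum>l\<in>?I. ?b l *\<^sub>R ?w l)) G"
    unfolding sum_b by (rule Lim_transform_eventually[OF tendsto_C2(2)[OF f x_lim]])
  then have lim: "((\<lambda>i. ?a i l) \<longlongrightarrow> ?b l) G" if "l \<in> ?I" for l
    using lin_indep_coefficients_converge[of ?I ?w ?W G ?a ?b] W LICQ that
    by (simp add: MPCC_LICQ_def)
  show "((\<lambda>i. \<alpha>1 i j) \<longlongrightarrow> s1 j) G" if "j \<in> A01 \<union> A00"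
    using lim[of "Inl j"] that by auto
  show "((\<lambda>i. \<alpha>2 i j) \<longlongrightarrow> s2 j) G" if "j \<in> A10 \<union> A00"
    using lim[of "Inr j"] that by auto
qed

text \<open>On \<open>a01\<close>, which is not covered by linear independence, \<open>\<alpha>\<^sub>2\<close> is the tilt, which tends to \<open>0\<close>, times a
  convergent \<open>\<alpha>\<^sub>1\<close>.\<close>
lemma mult2_lim: "((\<lambda>i. \<alpha>2 i j) \<longlongrightarrow> s2 j) G"
proof (cases "j \<in> A01")
  case True
  have lim: "((\<lambda>i. tilt F1 F2 (t i) A01 (x i) j * \<alpha>1 i j) \<longlongrightarrow> 0 * s1 j) G"
    using True by (intro tendsto_mult tilt_lim mult_lim_main) auto
  have ev: "eventually (\<lambda>i. tilt F1 F2 (t i) A01 (x i) j * \<alpha>1 i j = \<alpha>2 i j) G"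
    using F2_pos_ev[OF True]
    by eventually_elim (simp add: KKT_tilt(1)[OF KKT t_pos True])
  moreover have "s2 j = 0" using True by (auto simp: limit_mult_def a01_def a10_def a00_def)
  ultimately show ?thesis using Lim_transform_eventually[OF lim ev] by simp
qed (use mult_lim_main(2) index_cases in blast)

lemma mult1_lim: "((\<lambda>i. \<alpha>1 i j) \<longlongrightarrow> s1 j) G"
  using scholtes_limit.mult2_lim[OF swap] by (simp only: a10_swap[of F2 F1] a00_swap[of F2 F1])

end

section \<open>Lagrange Hessians, active constraints and critical directions\<close>

text \<open>Half the contribution of the product constraint \<open>j\<close> to the Hessian form of the Scholtes Lagrange
  function that stems from the mixed first derivatives.\<close>
definition coupling ::
    "(real ^ 'n \<Rightarrow> real ^ 'k) \<Rightarrow> (real ^ 'n \<Rightarrow> real ^ 'k) \<Rightarrow> ('k \<Rightarrow> real) \<Rightarrow> real ^ 'n \<Rightarrow> 'k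
      \<Rightarrow> real ^ 'n \<Rightarrow> real"
  where "coupling F1 F2 \<eta> y j \<xi> = \<eta> j * ((Dcomp F1 j y \<bullet> \<xi>) * (Dcomp F2 j y \<bullet> \<xi>))"

lemma coupling_swap: "coupling F2 F1 = coupling F1 F2"
  by (simp add: coupling_def fun_eq_iff)

lemma tangent_Scholtes_swap: "tangent_Scholtes F2 F1 = tangent_Scholtes F1 F2"
  by (auto simp: tangent_Scholtes_def DH_swap[of F2 F1] act_H_swap[of F2 F1] fun_eq_iff)

lemma sum_limit_mult:
  fixes h :: "'k::finite \<Rightarrow> real"
  assumes "A \<inter> B = {}"
  shows "(\<Sum>j\<in>UNIV. limit_mult A B \<sigma> \<rho> j * h j) = (\<Sum>j\<in>A. \<sigma> j * h j) + (\<Sum>j\<in>B. \<rho> j * h j)"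
proof -
  have "(\<Sum>j\<in>UNIV. limit_mult A B \<sigma> \<rho> j * h j) = (\<Sum>j\<in>A \<union> B. limit_mult A B \<sigma> \<rho> j * h j)"
    by (rule sum.mono_neutral_right) (auto simp: limit_mult_def)
  also have "\<dots> = (\<Sum>j\<in>A. limit_mult A B \<sigma> \<rho> j * h j) + (\<Sum>j\<in>B. limit_mult A B \<sigma> \<rho> j * h j)"
    using assms by (simp add: sum.union_disjoint)
  also have "\<dots> = (\<Sum>j\<in>A. \<sigma> j * h j) + (\<Sum>j\<in>B. \<rho> j * h j)"
    using assms by (auto simp: limit_mult_def intro!: arg_cong2[where f = "(+)"] sum.cong)
  finally show ?thesis .
qed

context scholtes_limit
begin

abbreviation "A00neg \<equiv> {j \<in> A00. \<rho>1 j < 0 \<and> \<rho>2 j < 0}"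
abbreviation "HS i \<equiv> hessian (lagrange_Scholtes f F1 F2 (t i) (\<eta> i) (\<nu>1 i) (\<nu>2 i)) (x i)"
abbreviation "HM \<equiv> hessian (lagrange_MPCC f F1 F2 xb \<sigma>1 \<sigma>2 \<rho>1 \<rho>2) xb"
abbreviation "TS i \<equiv> tangent_Scholtes F1 F2 (t i) (x i)"
abbreviation "TM \<equiv> tangent_MPCC F1 F2 xb"

lemma HS_form:
  "(HS i *v \<xi>) \<bullet> \<zeta> = (hessian f (x i) *v \<xi>) \<bullet> \<zeta>
     - (\<Sum>j\<in>UNIV. \<alpha>1 i j * ((hessian (\<lambda>y. F1 y $ j) (x i) *v \<xi>) \<bullet> \<zeta>))
     - (\<Sum>j\<in>UNIV. \<alpha>2 i j * ((hessian (\<lambda>y. F2 y $ j) (x i) *v \<xi>) \<bullet> \<zeta>))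
     + (\<Sum>j\<in>UNIV. \<eta> i j * ((Dcomp F1 j (x i) \<bullet> \<xi>) * (Dcomp F2 j (x i) \<bullet> \<zeta>)
                        + (Dcomp F2 j (x i) \<bullet> \<xi>) * (Dcomp F1 j (x i) \<bullet> \<zeta>)))"
  unfolding eff_mult_def
  by (rule hessian_lagrangian_form[OF f F1 F2, where k = "\<Sum>j\<in>UNIV. \<eta> i j * t i"])
    (simp add: lagrange_Scholtes_def right_diff_distrib sum_subtractf)

lemma HM_form:
  "(HM *v \<xi>) \<bullet> \<zeta> = (hessian f xb *v \<xi>) \<bullet> \<zeta>
     - (\<Sum>j\<in>UNIV. s1 j * ((hessian (\<lambda>y. F1 y $ j) xb *v \<xi>) \<bullet> \<zeta>))
     - (\<Sum>j\<in>UNIV. s2 j * ((hessian (\<lambda>y. F2 y $ j) xb *v \<xi>) \<bullet> \<zeta>))"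
proof -
  have "A01 \<inter> A00 = {}" "A10 \<inter> A00 = {}"
    by (auto simp: a01_def a10_def a00_def)
  then have "lagrange_MPCC f F1 F2 xb \<sigma>1 \<sigma>2 \<rho>1 \<rho>2 y
      = f y - (\<Sum>j\<in>UNIV. s1 j * F1 y $ j) - (\<Sum>j\<in>UNIV. s2 j * F2 y $ j)
        + (\<Sum>j\<in>UNIV. 0 * (F1 y $ j * F2 y $ j)) - 0" for y
    by (simp add: lagrange_MPCC_def sum_limit_mult sum.distrib)
  from hessian_lagrangian_form[OF f F1 F2 this, of xb \<xi> \<zeta>] show ?thesis by simp
qed

lemma HS_sym: "(HS i *v \<xi>) \<bullet> \<zeta> = (HS i *v \<zeta>) \<bullet> \<xi>"
  unfolding HS_form
  by (simp add: hessian_symmetric[OF f, of _ \<xi>] hessian_symmetric[OF C2_vecD[OF F1], of _ _ \<xi>]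
      hessian_symmetric[OF C2_vecD[OF F2], of _ _ \<xi>] algebra_simps)

lemma HM_sym: "(HM *v \<xi>) \<bullet> \<zeta> = (HM *v \<zeta>) \<bullet> \<xi>"
  unfolding HM_form
  by (simp add: hessian_symmetric[OF f, of _ \<xi>] hessian_symmetric[OF C2_vecD[OF F1], of _ _ \<xi>]
      hessian_symmetric[OF C2_vecD[OF F2], of _ _ \<xi>])

lemma subspace_TS: "subspace (TS i)" and subspace_TM: "subspace TM"
  by (auto simp: subspace_def tangent_Scholtes_def tangent_MPCC_def inner_add_right)

text \<open>MPCC-LICQ says that the conditions defining the tangent space are independent.\<close>
lemma dim_TM: "dim TM + card A01 + card A10 + 2 * card A00 = CARD('n)"
proof -
  let ?I = "(A01 \<union> A00) <+> (A10 \<union> A00)"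
  let ?w = "case_sum (\<lambda>j. Dcomp F1 j xb) (\<lambda>j. Dcomp F2 j xb)"
  have w: "inj_on ?w ?I" "independent (?w ` ?I)"
    using LICQ by (auto simp: MPCC_LICQ_def lin_indep_family_def)
  have "TM = {y. \<forall>v\<in>span (?w ` ?I). orthogonal v y}"
  proof (intro set_eqI iffI)
    fix y assume y: "y \<in> TM"
    have "orthogonal y v" if "v \<in> ?w ` ?I" for v
      using that y by (auto simp: tangent_MPCC_def orthogonal_def inner_commute)
    then show "y \<in> {y. \<forall>v\<in>span (?w ` ?I). orthogonal v y}"
      using orthogonal_to_span orthogonal_commute by blast
  next
    fix y assume y: "y \<in> {y. \<forall>v\<in>span (?w ` ?I). orthogonal v y}"
    have "?w l \<bullet> y = 0" if "l \<in> ?I" for l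
      using y that by (auto simp: orthogonal_def span_base)
    from this[of "Inl _"] this[of "Inr _"] show "y \<in> TM"
      by (auto simp: tangent_MPCC_def)
  qed
  then have "dim TM + dim (span (?w ` ?I)) = CARD('n)"
    using dim_subspace_orthogonal_to_vectors[of "span (?w ` ?I)" UNIV] by simp
  moreover have "dim (span (?w ` ?I)) = card ?I"
    using w by (simp add: dim_eq_card_independent card_image)
  moreover have "A01 \<inter> A00 = {}" "A10 \<inter> A00 = {}"
    by (auto simp: a01_def a10_def a00_def)
  ultimately show ?thesis
    by (simp add: card_Plus card_Un_disjoint)
qed

text \<open>What holds for all late members of the family: positivity at \<open>xb\<close> persists, the
  constraints at biactive indices have become active or inactive according to the signs of the
  multipliers, and an index of \<open>a01\<close> or \<open>a10\<close> can be inactive only if its multiplier vanishes.\<close>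
definition settled :: "'i \<Rightarrow> bool" where
  "settled i \<longleftrightarrow>
     (\<forall>j\<in>A01. F2 (x i) $ j > 0 \<and> (\<sigma>1 j \<noteq> 0 \<longrightarrow> j \<in> act_H F1 F2 (t i) (x i) \<union> act_N F1 (x i)))
   \<and> (\<forall>j\<in>A10. F1 (x i) $ j > 0 \<and> (\<sigma>2 j \<noteq> 0 \<longrightarrow> j \<in> act_H F1 F2 (t i) (x i) \<union> act_N F2 (x i)))
   \<and> (\<forall>j\<in>A00neg. j \<in> act_H F1 F2 (t i) (x i) \<and> F1 (x i) $ j > 0 \<and> F2 (x i) $ j > 0)
   \<and> (\<forall>j\<in>A00 - A00neg. F1 (x i) $ j = 0 \<and> F2 (x i) $ j = 0)"

text \<open>If neither the product constraint nor \<open>F\<^sub>1 \<ge> 0\<close> is active, then \<open>\<eta> = \<nu>\<^sub>1 = 0\<close>, so \<open>\<alpha>\<^sub>1 = 0\<close>; but \<open>\<alpha>\<^sub>1\<close> tends to \<open>\<sigma>\<^sub>1 \<noteq> 0\<close>.\<close>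
lemma active_ev:
  assumes "j \<in> A01" "\<sigma>1 j \<noteq> 0"
  shows "eventually (\<lambda>i. j \<in> act_H F1 F2 (t i) (x i) \<union> act_N F1 (x i)) G"
proof -
  have "s1 j \<noteq> 0" using assms by (simp add: limit_mult_def)
  then have "eventually (\<lambda>i. \<alpha>1 i j \<noteq> 0) G"
    by (rule tendsto_imp_eventually_ne[OF mult1_lim])
  then show ?thesis
  proof eventually_elim
    case (elim i)
    have "\<eta> i j = 0 \<or> t i = F1 (x i) $ j * F2 (x i) $ j" "\<nu>1 i j = 0 \<or> F1 (x i) $ j = 0"
      using KKT[of i] by (simp_all add: KKT_Scholtes_def)
    then show ?case
      using elim by (auto simp: eff_mult_def act_H_def act_N_def)
  qed
qed

lemma A00_limits: "j \<in> A00 \<Longrightarrow> s1 j = \<rho>1 j \<and> s2 j = \<rho>2 j"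
  by (auto simp: limit_mult_def a01_def a10_def a00_def)

text \<open>A positive \<open>\<alpha>\<^sub>1 = \<nu>\<^sub>1 - \<eta> F\<^sub>2\<close> forces \<open>\<nu>\<^sub>1 > 0\<close> and hence \<open>F\<^sub>1 = 0\<close>.\<close>
lemma biactive_pos_ev:
  assumes "j \<in> A00 - A00neg"
  shows "eventually (\<lambda>i. F1 (x i) $ j = 0) G"
proof -
  have "s1 j > 0"
    using assms rho_pos[of j] A00_limits[of j] by (auto simp: zero_less_mult_iff)
  then have "eventually (\<lambda>i. \<alpha>1 i j > 0) G"
    by (rule order_tendstoD[OF mult1_lim])
  then show ?thesis
  proof eventually_elim
    case (elim i)
    have "0 \<le> \<eta> i j * F2 (x i) $ j"
      using KKT[of i] by (auto simp: KKT_Scholtes_def feas_Scholtes_def)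
    then have "\<nu>1 i j \<noteq> 0" using elim by (auto simp: eff_mult_def)
    then show ?case using KKT[of i] by (auto simp: KKT_Scholtes_def)
  qed
qed

text \<open>A negative \<open>\<alpha>\<^sub>1 = \<nu>\<^sub>1 - \<eta> F\<^sub>2\<close> forces \<open>\<eta> > 0\<close>, so the product equals \<open>t > 0\<close>.\<close>
lemma biactive_neg_ev:
  assumes "j \<in> A00neg"
  shows "eventually (\<lambda>i. j \<in> act_H F1 F2 (t i) (x i) \<and> F1 (x i) $ j > 0 \<and> F2 (x i) $ j > 0) G"
proof -
  have "s1 j < 0"
    using assms A00_limits[of j] by auto
  then have "eventually (\<lambda>i. \<alpha>1 i j < 0) G"
    by (rule order_tendstoD[OF mult1_lim])
  then show ?thesis
  proof eventually_elim
    case (elim i)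
    have "\<eta> i j \<noteq> 0"
    proof
      assume "\<eta> i j = 0"
      moreover have "\<nu>1 i j \<ge> 0" using KKT[of i] by (auto simp: KKT_Scholtes_def)
      ultimately show False using elim by (simp add: eff_mult_def)
    qed
    then have "F1 (x i) $ j * F2 (x i) $ j = t i"
      using KKT[of i] by (auto simp: KKT_Scholtes_def)
    moreover have "F1 (x i) $ j \<ge> 0" "F2 (x i) $ j \<ge> 0"
      using KKT[of i] by (auto simp: KKT_Scholtes_def feas_Scholtes_def)
    ultimately show ?case
      using t_pos[of i] by (auto simp: act_H_def zero_less_mult_iff order.order_iff_strict)
  qed
qed

lemma A00neg_swap: "{j \<in> A00. \<rho>2 j < 0 \<and> \<rho>1 j < 0} = A00neg"
  by auto

lemma settled_ev: "eventually settled G"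
proof -
  note swapped = scholtes_limit.active_ev[OF swap, unfolded a01_swap[of F2 F1] act_H_swap[of F2 F1]]
    scholtes_limit.biactive_pos_ev[OF swap, unfolded a00_swap[of F2 F1] A00neg_swap]
  have imp: "eventually (\<lambda>i. Q \<longrightarrow> R i) G" if "Q \<Longrightarrow> eventually R G" for Q R
    using that by (cases Q) auto
  have "eventually (\<lambda>i. \<forall>j\<in>A00neg. j \<in> act_H F1 F2 (t i) (x i) \<and> F1 (x i) $ j > 0 \<and> F2 (x i) $ j > 0) G"
    using biactive_neg_ev by (intro eventually_ball_finite) auto
  moreover have "eventually (\<lambda>i. \<forall>j\<in>A00 - A00neg. F1 (x i) $ j = 0 \<and> F2 (x i) $ j = 0) G"
    by (intro eventually_conj eventually_ball_finite ballI finite biactive_pos_ev swapped)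
  moreover have "eventually (\<lambda>i. \<forall>j\<in>A01. F2 (x i) $ j > 0
      \<and> (\<sigma>1 j \<noteq> 0 \<longrightarrow> j \<in> act_H F1 F2 (t i) (x i) \<union> act_N F1 (x i))) G"
    by (intro eventually_conj eventually_ball_finite ballI imp finite F2_pos_ev active_ev)
  moreover have "eventually (\<lambda>i. \<forall>j\<in>A10. F1 (x i) $ j > 0
      \<and> (\<sigma>2 j \<noteq> 0 \<longrightarrow> j \<in> act_H F1 F2 (t i) (x i) \<union> act_N F2 (x i))) G"
    by (intro eventually_conj eventually_ball_finite ballI imp finite F1_pos_ev swapped)
  ultimately show ?thesis
    unfolding settled_def by eventually_elim blast
qed

lemma tilted_tangent:
  assumes "settled i" "j \<in> A01" "\<xi> \<in> TS i"
    and "j \<notin> act_H F1 F2 (t i) (x i) \<Longrightarrow> j \<notin> act_N F1 (x i) \<Longrightarrow> Dcomp F1 j (x i) \<bullet> \<xi> = 0"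
  shows "w1 i j \<bullet> \<xi> = 0"
proof (cases "j \<in> act_H F1 F2 (t i) (x i)")
  case True
  then show ?thesis
    using assms by (intro DH_tangent_tilted) (auto simp: settled_def tangent_Scholtes_def)
next
  case False
  then have "Dcomp F1 j (x i) \<bullet> \<xi> = 0"
    using assms by (auto simp: tangent_Scholtes_def)
  with False show ?thesis by (simp add: tilted_grad_def tilt_def)
qed

lemma tilted_active:
  assumes "settled i" "j \<in> A01" "w1 i j \<bullet> \<xi> = 0"
  shows "j \<in> act_H F1 F2 (t i) (x i) \<Longrightarrow> DH F1 F2 j (x i) \<bullet> \<xi> = 0"
    and "j \<in> act_N F1 (x i) \<Longrightarrow> Dcomp F1 j (x i) \<bullet> \<xi> = 0"
  using assms t_pos[of i]
  by (auto simp: settled_def tilted_grad_def tilt_def act_H_def act_N_def DH_def inner_add_left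
      field_simps)

lemma settled_swap: "scholtes_limit.settled F2 F1 t x xb \<sigma>2 \<sigma>1 \<rho>2 \<rho>1 = settled"
  unfolding scholtes_limit.settled_def[OF swap] settled_def[abs_def] fun_eq_iff
    A00neg_swap a00_swap[of F2 F1] a01_swap[of F2 F1] a10_swap[of F2 F1] act_H_swap[of F2 F1]
  by blast

lemmas tilted_tangent2 = scholtes_limit.tilted_tangent[OF swap, unfolded settled_swap
    a01_swap[of F2 F1] act_H_swap[of F2 F1] tangent_Scholtes_swap[of F2 F1]]
lemmas tilted_active2 = scholtes_limit.tilted_active[OF swap, unfolded settled_swap
    a01_swap[of F2 F1] act_H_swap[of F2 F1] DH_swap[of F2 F1]]

text \<open>Orthogonality to the following vectors suffices: the tilted gradients, both gradients at a positive
  biactive index, and the single gradient of the product at a negative one. The saving of one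
  condition per negative biactive index is the summand \<open>card A00neg\<close>. Indices of \<open>a01\<close> and \<open>a10\<close> are
  imposed whether active or not, which keeps the limit of the directions in the MPCC tangent space.\<close>
lemma critical_direction_of_codim:
  assumes i: "settled i" and V: "finite V"
    and card: "card V + card A01 + card A10 + 2 * card A00 < CARD('n) + card A00neg"
  shows "\<exists>\<xi>\<in>TS i. norm \<xi> = 1 \<and> (\<forall>j\<in>A01. w1 i j \<bullet> \<xi> = 0) \<and> (\<forall>j\<in>A10. w2 i j \<bullet> \<xi> = 0)
    \<and> (\<forall>v\<in>V. v \<bullet> \<xi> = 0)"
proof -
  let ?B = "A00 - A00neg"
  define U where "U = V \<union> w1 i ` A01 \<union> w2 i ` A10 \<union> (\<lambda>j. Dcomp F1 j (x i)) ` ?B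
    \<union> (\<lambda>j. Dcomp F2 j (x i)) ` ?B \<union> (\<lambda>j. DH F1 F2 j (x i)) ` A00neg"
  have "card U \<le> card V + card A01 + card A10 + card ?B + card ?B + card A00neg"
    unfolding U_def
    by (intro order_trans[OF card_Un_le] add_mono card_image_le order_refl finite)
  moreover have "card ?B + card A00neg = card A00"
    by (subst card_Un_disjoint[symmetric]) (auto intro!: arg_cong[where f = card])
  ultimately have "card U < dim (UNIV :: (real ^ 'n) set)"
    using card by (simp add: dim_UNIV)
  moreover have "finite U" using V by (simp add: U_def)
  ultimately obtain \<xi> where \<xi>: "norm \<xi> = 1" "\<forall>v\<in>U. v \<bullet> \<xi> = 0"
    using exists_unit_orthogonal[OF subspace_UNIV] by blast
  have 1: "w1 i j \<bullet> \<xi> = 0" if "j \<in> A01" for j using \<xi> that by (simp add: U_def)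
  have 2: "w2 i j \<bullet> \<xi> = 0" if "j \<in> A10" for j using \<xi> that by (simp add: U_def)
  have B: "Dcomp F1 j (x i) \<bullet> \<xi> = 0" "Dcomp F2 j (x i) \<bullet> \<xi> = 0" if "j \<in> ?B" for j
    using \<xi> that by (simp_all add: U_def)
  have M: "DH F1 F2 j (x i) \<bullet> \<xi> = 0" if "j \<in> A00neg" for j using \<xi> that by (simp add: U_def)
  have "\<xi> \<in> TS i"
    unfolding tangent_Scholtes_def
  proof (intro CollectI conjI ballI)
    fix j assume j: "j \<in> act_H F1 F2 (t i) (x i)"
    consider "j \<in> A01" | "j \<in> A10" | "j \<in> A00neg" | "j \<in> ?B" using index_cases by blast
    then show "DH F1 F2 j (x i) \<bullet> \<xi> = 0"
      by cases (use tilted_active(1)[OF i _ 1 j] tilted_active2(1)[OF i _ 2 j] M i j t_pos[of i]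
        in \<open>auto simp: settled_def act_H_def\<close>)
  next
    fix j assume j: "j \<in> act_N F1 (x i)"
    consider "j \<in> A01" | "j \<in> A10" | "j \<in> A00neg" | "j \<in> ?B" using index_cases by blast
    then show "Dcomp F1 j (x i) \<bullet> \<xi> = 0"
    proof cases
      case 1 with tilted_active(2)[OF i] j \<open>\<And>j. j \<in> A01 \<Longrightarrow> w1 i j \<bullet> \<xi> = 0\<close> show ?thesis by blast
    qed (use B i j in \<open>auto simp: settled_def act_N_def\<close>)
  next
    fix j assume j: "j \<in> act_N F2 (x i)"
    consider "j \<in> A01" | "j \<in> A10" | "j \<in> A00neg" | "j \<in> ?B" using index_cases by blast
    then show "Dcomp F2 j (x i) \<bullet> \<xi> = 0"
    proof cases
      case 2 with tilted_active2(2)[OF i] j \<open>\<And>j. j \<in> A10 \<Longrightarrow> w2 i j \<bullet> \<xi> = 0\<close> show ?thesis by blast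
    qed (use B i j in \<open>auto simp: settled_def act_N_def\<close>)
  qed
  then show ?thesis using \<xi> 1 2 by (auto simp: U_def)
qed

text \<open>Within the Scholtes tangent space, one condition for each possibly inactive index and one for
  each negative biactive index make up, in the limit, for the conditions of the MPCC tangent space
  that are missing there.\<close>
lemma critical_direction_in_tangent:
  assumes i: "settled i" and V: "finite V"
    and card: "card V + card {j \<in> A01. \<sigma>1 j = 0} + card {j \<in> A10. \<sigma>2 j = 0} + card A00neg < dim (TS i)"
  shows "\<exists>\<xi>\<in>TS i. norm \<xi> = 1 \<and> (\<forall>j\<in>A01. w1 i j \<bullet> \<xi> = 0) \<and> (\<forall>j\<in>A10. w2 i j \<bullet> \<xi> = 0)
    \<and> (\<forall>v\<in>V. v \<bullet> \<xi> = 0) \<and> (\<forall>j\<in>A00neg. Dcomp F2 j (x i) \<bullet> \<xi> = 0)"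
proof -
  let ?D1 = "{j \<in> A01. \<sigma>1 j = 0}" and ?D2 = "{j \<in> A10. \<sigma>2 j = 0}"
  define U where "U = V \<union> (\<lambda>j. Dcomp F1 j (x i)) ` ?D1 \<union> (\<lambda>j. Dcomp F2 j (x i)) ` ?D2
    \<union> (\<lambda>j. Dcomp F2 j (x i)) ` A00neg"
  have "card U \<le> card V + card ?D1 + card ?D2 + card A00neg"
    unfolding U_def
    by (intro order_trans[OF card_Un_le] add_mono card_image_le order_refl finite)
  then have "card U < dim (TS i)" using card by simp
  moreover have "finite U" using V by (simp add: U_def)
  ultimately obtain \<xi> where \<xi>: "\<xi> \<in> TS i" "norm \<xi> = 1" "\<forall>v\<in>U. v \<bullet> \<xi> = 0"
    using exists_unit_orthogonal[OF subspace_TS] by blast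
  have D1: "Dcomp F1 j (x i) \<bullet> \<xi> = 0" if "j \<in> ?D1" for j
    using \<xi>(3) that unfolding U_def by blast
  have D2: "Dcomp F2 j (x i) \<bullet> \<xi> = 0" if "j \<in> ?D2" for j
    using \<xi>(3) that unfolding U_def by blast
  have "w1 i j \<bullet> \<xi> = 0" if "j \<in> A01" for j
    using tilted_tangent[OF i that \<xi>(1)] D1[of j] i that by (auto simp: settled_def)
  moreover have "w2 i j \<bullet> \<xi> = 0" if "j \<in> A10" for j
    using tilted_tangent2[OF i that \<xi>(1)] D2[of j] i that by (auto simp: settled_def)
  ultimately show ?thesis using \<xi> unfolding U_def by blast
qed

end

section \<open>Limits of critical directions and comparison of the indices\<close>

text \<open>Tangency to the product constraint reads \<open>F\<^sub>2 (DF\<^sub>1 \<xi>) = - F\<^sub>1 (DF\<^sub>2 \<xi>)\<close>; inserting it into the coupling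
  term leaves a negative square.\<close>
lemma tangent_DH_normal:
  assumes "DH F1 F2 j y \<bullet> \<xi> = 0" "F1 y $ j > 0" "F2 y $ j > 0"
  shows "coupling F1 F2 \<eta> y j \<xi> * F2 y $ j = - (\<eta> j * F1 y $ j) * (Dcomp F2 j y \<bullet> \<xi>)\<^sup>2"
proof -
  have "F2 y $ j * (Dcomp F1 j y \<bullet> \<xi>) = - (F1 y $ j * (Dcomp F2 j y \<bullet> \<xi>))"
    using assms(1) by (simp add: DH_def inner_add_left)
  then have "\<eta> j * (F2 y $ j * (Dcomp F1 j y \<bullet> \<xi>)) * (Dcomp F2 j y \<bullet> \<xi>)
      = \<eta> j * (- (F1 y $ j * (Dcomp F2 j y \<bullet> \<xi>))) * (Dcomp F2 j y \<bullet> \<xi>)"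
    by simp
  then show ?thesis
    by (simp add: coupling_def power2_eq_square mult_ac)
qed

text \<open>Tangency to the Scholtes problem says nothing about indices without an active constraint. The
  conditions on the tilted gradients cover these too, so that the limit \<open>z\<close> satisfies all tangency
  conditions of the MPCC at \<open>a01\<close> and \<open>a10\<close>.\<close>
locale scholtes_direction_limit = scholtes_limit f F1 F2 G t x \<eta> \<nu>1 \<nu>2 xb \<sigma>1 \<sigma>2 \<rho>1 \<rho>2
  for f :: "real ^ 'n \<Rightarrow> real" and F1 F2 :: "real ^ 'n \<Rightarrow> real ^ 'k" and G :: "'i filter"
    and t x \<eta> \<nu>1 \<nu>2 xb \<sigma>1 \<sigma>2 \<rho>1 \<rho>2 +
  fixes \<xi> :: "'i \<Rightarrow> real ^ 'n" and z :: "real ^ 'n"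
  assumes nontriv: "G \<noteq> bot" and \<xi>_lim: "(\<xi> \<longlongrightarrow> z) G"
    and tan: "eventually (\<lambda>i. \<xi> i \<in> TS i) G"
    and w1_tan: "eventually (\<lambda>i. \<forall>j\<in>A01. w1 i j \<bullet> \<xi> i = 0) G"
    and w2_tan: "eventually (\<lambda>i. \<forall>j\<in>A10. w2 i j \<bullet> \<xi> i = 0) G"
begin

lemma dir_swap: "scholtes_direction_limit f F2 F1 G t x \<eta> \<nu>2 \<nu>1 xb \<sigma>2 \<sigma>1 \<rho>2 \<rho>1 \<xi> z"
  unfolding scholtes_direction_limit_def scholtes_direction_limit_axioms_def
    tangent_Scholtes_swap[of F2 F1] a01_swap[of F2 F1] a10_swap[of F2 F1]
  using swap nontriv \<xi>_lim tan w1_tan w2_tan by blast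

abbreviation "cpl i j \<equiv> coupling F1 F2 (\<eta> i) (x i) j (\<xi> i)"
abbreviation "form i \<equiv> (HS i *v \<xi> i) \<bullet> \<xi> i"

lemma g1_\<xi>_lim: "((\<lambda>i. Dcomp F1 j (x i) \<bullet> \<xi> i) \<longlongrightarrow> Dcomp F1 j xb \<bullet> z) G"
  and g2_\<xi>_lim: "((\<lambda>i. Dcomp F2 j (x i) \<bullet> \<xi> i) \<longlongrightarrow> Dcomp F2 j xb \<bullet> z) G"
  by (intro tendsto_inner g1_lim g2_lim \<xi>_lim)+

text \<open>Along \<open>\<xi>\<close> the tilted gradient vanishes, so \<open>DF\<^sub>1 \<xi>\<close> is minus the tilt times \<open>DF\<^sub>2 \<xi>\<close>; and \<open>\<eta>\<close> times the
  tilt is \<open>- \<alpha>\<^sub>2 / F\<^sub>2\<close>, which tends to \<open>0\<close>.\<close>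
lemma coupling_lim_A01:
  assumes j: "j \<in> A01"
  shows "((\<lambda>i. cpl i j) \<longlongrightarrow> 0) G"
proof -
  have "((\<lambda>i. \<alpha>2 i j / F2 (x i) $ j * (Dcomp F2 j (x i) \<bullet> \<xi> i)\<^sup>2)
      \<longlongrightarrow> s2 j / F2 xb $ j * (Dcomp F2 j xb \<bullet> z)\<^sup>2) G"
    using j by (intro tendsto_mult tendsto_divide tendsto_power mult2_lim F2_lim g2_\<xi>_lim)
      (simp add: a01_def)
  moreover have "s2 j = 0" using j by (auto simp: limit_mult_def a01_def a10_def a00_def)
  ultimately have "((\<lambda>i. \<alpha>2 i j / F2 (x i) $ j * (Dcomp F2 j (x i) \<bullet> \<xi> i)\<^sup>2) \<longlongrightarrow> 0) G"
    by simp
  moreover have "eventually (\<lambda>i. \<alpha>2 i j / F2 (x i) $ j * (Dcomp F2 j (x i) \<bullet> \<xi> i)\<^sup>2 = cpl i j) G"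
    using F2_pos_ev[OF j] w1_tan
  proof eventually_elim
    case (elim i)
    let ?c = "tilt F1 F2 (t i) A01 (x i) j" and ?h = "Dcomp F2 j (x i) \<bullet> \<xi> i"
    have g1: "Dcomp F1 j (x i) \<bullet> \<xi> i = - (?c * ?h)"
      using elim j by (auto simp: tilted_grad_def inner_add_left eq_neg_iff_add_eq_0)
    have "cpl i j = - (\<eta> i j * ?c) * ?h\<^sup>2"
      unfolding coupling_def g1 by (simp add: power2_eq_square)
    also have "\<eta> i j * ?c = - \<alpha>2 i j / F2 (x i) $ j"
      using elim j by (intro KKT_tilt(2)[OF KKT t_pos]) auto
    finally show ?case by simp
  qed
  ultimately show ?thesis by (rule Lim_transform_eventually)
qed

lemma coupling_lim:
  assumes "j \<notin> A00neg"
  shows "((\<lambda>i. cpl i j) \<longlongrightarrow> 0) G"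
proof -
  consider "j \<in> A01" | "j \<in> A10" | "j \<in> A00 - A00neg" using assms index_cases by blast
  then show ?thesis
  proof cases
    case 2
    then show ?thesis
      using scholtes_direction_limit.coupling_lim_A01[OF dir_swap, of j]
      by (simp add: a01_swap[of F2 F1] coupling_swap[of F2 F1])
  next
    case 3
    have "eventually (\<lambda>i. 0 = cpl i j) G"
      using settled_ev tan
      by eventually_elim (use 3 in \<open>auto simp: coupling_def settled_def tangent_Scholtes_def act_N_def\<close>)
    then show ?thesis by (rule Lim_transform_eventually[OF tendsto_const])
  qed (rule coupling_lim_A01)
qed

text \<open>The only part of the Scholtes form whose convergence is not automatic is the coupling at the negative
  biactive indices.\<close>
lemma form_lim: "((\<lambda>i. form i - 2 * (\<Sum>j\<in>A00neg. cpl i j)) \<longlongrightarrow> (HM *v z) \<bullet> z) G"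
proof -
  let ?q = "\<lambda>h i. (hessian h (x i) *v \<xi> i) \<bullet> \<xi> i"
  have q: "(?q h \<longlongrightarrow> (hessian h xb *v z) \<bullet> z) G" if "C2 h" for h
    by (intro tendsto_inner tendsto_matrix_vector_mult tendsto_hessian that x_lim \<xi>_lim)
  have "((\<lambda>i. ?q f i - (\<Sum>j\<in>UNIV. \<alpha>1 i j * ?q (\<lambda>y. F1 y $ j) i)
       - (\<Sum>j\<in>UNIV. \<alpha>2 i j * ?q (\<lambda>y. F2 y $ j) i) + 2 * (\<Sum>j\<in>UNIV - A00neg. cpl i j))
     \<longlongrightarrow> (hessian f xb *v z) \<bullet> z - (\<Sum>j\<in>UNIV. s1 j * ((hessian (\<lambda>y. F1 y $ j) xb *v z) \<bullet> z))
       - (\<Sum>j\<in>UNIV. s2 j * ((hessian (\<lambda>y. F2 y $ j) xb *v z) \<bullet> z)) + 2 * (\<Sum>j\<in>UNIV - A00neg. 0)) G"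
    by (intro tendsto_add tendsto_diff tendsto_sum tendsto_mult tendsto_const q f mult1_lim mult2_lim
        coupling_lim C2_vecD[OF F1] C2_vecD[OF F2]) auto
  moreover have "form i - 2 * (\<Sum>j\<in>A00neg. cpl i j)
      = ?q f i - (\<Sum>j\<in>UNIV. \<alpha>1 i j * ?q (\<lambda>y. F1 y $ j) i)
       - (\<Sum>j\<in>UNIV. \<alpha>2 i j * ?q (\<lambda>y. F2 y $ j) i) + 2 * (\<Sum>j\<in>UNIV - A00neg. cpl i j)" for i
  proof -
    have "(\<Sum>j\<in>UNIV. \<eta> i j * ((Dcomp F1 j (x i) \<bullet> \<xi> i) * (Dcomp F2 j (x i) \<bullet> \<xi> i)
              + (Dcomp F2 j (x i) \<bullet> \<xi> i) * (Dcomp F1 j (x i) \<bullet> \<xi> i)))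
        = 2 * (\<Sum>j\<in>UNIV. cpl i j)"
      by (simp add: coupling_def sum_distrib_left mult_ac)
    also have "(\<Sum>j\<in>UNIV. cpl i j) = (\<Sum>j\<in>A00neg. cpl i j) + (\<Sum>j\<in>UNIV - A00neg. cpl i j)"
      by (simp add: sum.subset_diff[of A00neg UNIV])
    finally show ?thesis unfolding HS_form by simp
  qed
  ultimately show ?thesis by (simp add: HM_form)
qed

text \<open>At a negative biactive index tangency to the Scholtes problem gives a single condition instead of
  two, which is why the two conditions are assumed there.\<close>
lemma limit_in_tangent_MPCC:
  assumes "\<And>j. j \<in> A00neg \<Longrightarrow> Dcomp F1 j xb \<bullet> z = 0" "\<And>j. j \<in> A00neg \<Longrightarrow> Dcomp F2 j xb \<bullet> z = 0"
  shows "z \<in> TM"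
proof -
  have zero: "l = 0" if "(h \<longlongrightarrow> l) G" "eventually (\<lambda>i. h i = 0) G" for h and l :: real
    using tendsto_unique[OF nontriv that(1)] tendsto_eventually[OF that(2)] by blast
  have "Dcomp F1 j xb \<bullet> z = 0" if "j \<in> A01" for j
    by (rule zero[OF tendsto_inner[OF w1_lim \<xi>_lim]]) (use w1_tan that in \<open>auto elim: eventually_mono\<close>)
  moreover have "Dcomp F2 j xb \<bullet> z = 0" if "j \<in> A10" for j
    by (rule zero[OF tendsto_inner[OF w2_lim \<xi>_lim]]) (use w2_tan that in \<open>auto elim: eventually_mono\<close>)
  moreover have "Dcomp F1 j xb \<bullet> z = 0 \<and> Dcomp F2 j xb \<bullet> z = 0" if j: "j \<in> A00 - A00neg" for j
  proof -
    have ev: "eventually (\<lambda>i. Dcomp F1 j (x i) \<bullet> \<xi> i = 0 \<and> Dcomp F2 j (x i) \<bullet> \<xi> i = 0) G"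
      using settled_ev tan
      by eventually_elim (use j in \<open>auto simp: settled_def tangent_Scholtes_def act_N_def\<close>)
    show ?thesis
      using zero[OF g1_\<xi>_lim] zero[OF g2_\<xi>_lim] ev by (auto simp: eventually_conj_iff)
  qed
  ultimately show ?thesis
    using assms unfolding tangent_MPCC_def by blast
qed

lemma biactive_coupling:
  assumes "settled i" "\<xi> i \<in> TS i" "j \<in> A00neg"
  shows "cpl i j * F2 (x i) $ j = \<alpha>2 i j * (Dcomp F2 j (x i) \<bullet> \<xi> i)\<^sup>2" and "cpl i j \<le> 0"
proof -
  have j: "DH F1 F2 j (x i) \<bullet> \<xi> i = 0" "F1 (x i) $ j > 0" "F2 (x i) $ j > 0"
    using assms by (auto simp: settled_def tangent_Scholtes_def)
  have "\<nu>2 i j * F2 (x i) $ j = 0" and \<eta>: "\<eta> i j \<ge> 0"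
    using KKT[of i] by (simp_all add: KKT_Scholtes_def)
  then have "\<alpha>2 i j = - (\<eta> i j * F1 (x i) $ j)"
    using j by (simp add: eff_mult_def)
  then show eq: "cpl i j * F2 (x i) $ j = \<alpha>2 i j * (Dcomp F2 j (x i) \<bullet> \<xi> i)\<^sup>2"
    using tangent_DH_normal[OF j, of "\<eta> i"] by simp
  have "\<alpha>2 i j \<le> 0"
    unfolding \<open>\<alpha>2 i j = _\<close> using \<eta> j by simp
  then have "cpl i j * F2 (x i) $ j \<le> 0"
    unfolding eq by (simp add: mult_nonpos_nonneg)
  then show "cpl i j \<le> 0"
    using j(3) by (simp add: mult_le_0_iff)
qed

text \<open>If the form stays nonnegative, the nonpositive coupling terms are bounded, since they sum up to the
  difference of the form and a convergent quantity. As \<open>(DF\<^sub>2 \<xi>)\<^sup>2\<close> is such a term times \<open>F\<^sub>2 / \<alpha>\<^sub>2\<close>, with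
  \<open>F\<^sub>2\<close> tending to \<open>0\<close> and \<open>\<alpha>\<^sub>2\<close> to a negative number, it tends to \<open>0\<close>.\<close>
lemma biactive_limit_zero:
  assumes form: "eventually (\<lambda>i. 0 \<le> form i) G" and j: "j \<in> A00neg"
  shows "Dcomp F2 j xb \<bullet> z = 0"
proof -
  let ?R = "\<lambda>i. form i - 2 * (\<Sum>j\<in>A00neg. cpl i j)"
  let ?h = "\<lambda>i. Dcomp F2 j (x i) \<bullet> \<xi> i"
  have s2: "s2 j < 0" and F20: "F2 xb $ j = 0"
    using j A00_limits[of j] by (auto simp: a00_def)
  have "eventually (\<lambda>i. \<alpha>2 i j < 0) G"
    by (rule order_tendstoD(2)[OF mult2_lim s2])
  then have "eventually (\<lambda>i. (?h i)\<^sup>2 \<le> ?R i * F2 (x i) $ j / (- 2 * \<alpha>2 i j)) G"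
    using form settled_ev tan
  proof eventually_elim
    case (elim i)
    have "- 2 * cpl i j \<le> - 2 * (\<Sum>j\<in>A00neg. cpl i j)"
      using member_le_sum[of j A00neg "\<lambda>j. - cpl i j"] j biactive_coupling(2)[OF elim(3,4)]
      by (simp add: sum_negf)
    then have "- 2 * cpl i j \<le> ?R i" using elim(2) by linarith
    moreover have "0 \<le> F2 (x i) $ j" using elim(3) j by (auto simp: settled_def)
    ultimately have "- 2 * cpl i j * F2 (x i) $ j \<le> ?R i * F2 (x i) $ j"
      by (rule mult_right_mono)
    also have "- 2 * cpl i j * F2 (x i) $ j = (?h i)\<^sup>2 * (- 2 * \<alpha>2 i j)"
      using biactive_coupling(1)[OF elim(3,4) j] by simp
    finally show ?case
      using elim(1) by (subst pos_le_divide_eq) auto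
  qed
  moreover have "((\<lambda>i. ?R i * F2 (x i) $ j / (- 2 * \<alpha>2 i j))
      \<longlongrightarrow> (HM *v z) \<bullet> z * F2 xb $ j / (- 2 * s2 j)) G"
    by (intro tendsto_divide tendsto_mult tendsto_const form_lim F2_lim mult2_lim) (use s2 in simp)
  moreover have "((\<lambda>i. (?h i)\<^sup>2) \<longlongrightarrow> (Dcomp F2 j xb \<bullet> z)\<^sup>2) G"
    by (intro tendsto_power g2_\<xi>_lim)
  ultimately have "(Dcomp F2 j xb \<bullet> z)\<^sup>2 \<le> (HM *v z) \<bullet> z * F2 xb $ j / (- 2 * s2 j)"
    using tendsto_le[OF nontriv] by blast
  then show ?thesis by (simp add: F20)
qed

lemma HS_swap:
  "(hessian (lagrange_Scholtes f F2 F1 (t i) (\<eta> i) (\<nu>2 i) (\<nu>1 i)) (x i)) = HS i"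
proof -
  have "lagrange_Scholtes f F2 F1 (t i) (\<eta> i) (\<nu>2 i) (\<nu>1 i)
      = lagrange_Scholtes f F1 F2 (t i) (\<eta> i) (\<nu>1 i) (\<nu>2 i)"
    by (simp add: lagrange_Scholtes_def fun_eq_iff mult.commute)
  then show ?thesis by simp
qed

lemma nonneg_direction_limit:
  assumes form: "eventually (\<lambda>i. 0 \<le> form i) G"
  shows "z \<in> TM" and "0 \<le> (HM *v z) \<bullet> z"
proof -
  have "Dcomp F1 j xb \<bullet> z = 0" if "j \<in> A00neg" for j
    using scholtes_direction_limit.biactive_limit_zero[OF dir_swap, unfolded HS_swap
        a00_swap[of F2 F1] A00neg_swap] form that by blast
  then show "z \<in> TM"
    using biactive_limit_zero[OF form] by (intro limit_in_tangent_MPCC)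
  have "eventually (\<lambda>i. 0 \<le> form i - 2 * (\<Sum>j\<in>A00neg. cpl i j)) G"
    using form settled_ev tan
  proof eventually_elim
    case (elim i)
    have "(\<Sum>j\<in>A00neg. cpl i j) \<le> 0"
      by (intro sum_nonpos biactive_coupling(2)[OF elim(2,3)])
    then show ?case using elim(1) by linarith
  qed
  then show "0 \<le> (HM *v z) \<bullet> z"
    using tendsto_lowerbound[OF form_lim] nontriv by blast
qed

lemma nonpos_direction_limit:
  assumes form: "eventually (\<lambda>i. form i \<le> 0) G"
    and m: "eventually (\<lambda>i. \<forall>j\<in>A00neg. Dcomp F2 j (x i) \<bullet> \<xi> i = 0) G"
  shows "z \<in> TM" and "(HM *v z) \<bullet> z \<le> 0"
proof -
  have zero: "l = 0" if "(h \<longlongrightarrow> l) G" "eventually (\<lambda>i. h i = 0) G" for h and l :: real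
    using tendsto_unique[OF nontriv that(1)] tendsto_eventually[OF that(2)] by blast
  have m1: "eventually (\<lambda>i. \<forall>j\<in>A00neg. Dcomp F1 j (x i) \<bullet> \<xi> i = 0) G"
    using m settled_ev tan
  proof eventually_elim
    case (elim i)
    show ?case
    proof
      fix j assume j: "j \<in> A00neg"
      then have "DH F1 F2 j (x i) \<bullet> \<xi> i = 0" "F2 (x i) $ j > 0"
        using elim(2,3) by (auto simp: settled_def tangent_Scholtes_def)
      then show "Dcomp F1 j (x i) \<bullet> \<xi> i = 0"
        using elim(1) j by (simp add: DH_def inner_add_left)
    qed
  qed
  show "z \<in> TM"
  proof (rule limit_in_tangent_MPCC)
    fix j assume j: "j \<in> A00neg"
    show "Dcomp F1 j xb \<bullet> z = 0"
      by (rule zero[OF g1_\<xi>_lim]) (use m1 in \<open>eventually_elim, use j in blast\<close>)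
    show "Dcomp F2 j xb \<bullet> z = 0"
      by (rule zero[OF g2_\<xi>_lim]) (use m in \<open>eventually_elim, use j in blast\<close>)
  qed
  have "eventually (\<lambda>i. form i - 2 * (\<Sum>j\<in>A00neg. cpl i j) \<le> 0) G"
    using form m by eventually_elim (simp add: coupling_def)
  then show "(HM *v z) \<bullet> z \<le> 0"
    using tendsto_upperbound[OF form_lim] nontriv by blast
qed

end

text \<open>Compactness of the unit sphere, phrased with the filter generated by a convergent subsequence.\<close>
lemma unit_sequence_subfilter:
  fixes Q :: "nat \<Rightarrow> real ^ 'n \<Rightarrow> bool"
  assumes "eventually (\<lambda>i. \<exists>\<xi>. norm \<xi> = 1 \<and> Q i \<xi>) sequentially"
  obtains \<xi> z G where "G \<noteq> bot" "G \<le> sequentially" "(\<xi> \<longlongrightarrow> z) G" "norm z = 1"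
    "eventually (\<lambda>i. Q i (\<xi> i)) G"
proof -
  obtain u :: "real ^ 'n" where u: "norm u = 1" using norm_axis_1 by blast
  \<comment> \<open>an arbitrary unit vector at the early \<open>i\<close> without a solution keeps the sequence on the sphere\<close>
  define \<xi> where "\<xi> i = (if \<exists>\<xi>. norm \<xi> = 1 \<and> Q i \<xi> then SOME \<xi>. norm \<xi> = 1 \<and> Q i \<xi> else u)" for i
  have \<xi>: "norm (\<xi> i) = 1 \<and> Q i (\<xi> i)" if "\<exists>\<xi>. norm \<xi> = 1 \<and> Q i \<xi>" for i
    using someI_ex[OF that] that by (simp add: \<xi>_def)
  have "\<forall>i. \<xi> i \<in> sphere 0 1"
  proof
    fix i show "\<xi> i \<in> sphere 0 1"
    proof (cases "\<exists>\<xi>. norm \<xi> = 1 \<and> Q i \<xi>")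
      case False
      then have "\<xi> i = u" unfolding \<xi>_def by (rule if_not_P)
      then show ?thesis using u by simp
    qed (use \<xi> in simp)
  qed
  then obtain z r where r: "z \<in> sphere 0 1" "strict_mono r" "(\<xi> \<circ> r) \<longlonglongrightarrow> z"
    using compact_sphere[of 0 1] unfolding compact_eq_seq_compact_metric seq_compact_def by metis
  let ?G = "filtermap r sequentially"
  have le: "?G \<le> sequentially"
    using filterlim_subseq[OF r(2)] by (simp add: filterlim_def)
  show thesis
  proof
    show "?G \<noteq> bot" by (simp add: filtermap_bot_iff)
    show "?G \<le> sequentially" by (rule le)
    show "(\<xi> \<longlongrightarrow> z) ?G" using r(3) by (simp add: filterlim_filtermap comp_def)
    show "norm z = 1" using r(1) by simp
    show "eventually (\<lambda>i. Q i (\<xi> i)) ?G"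
      by (rule filter_leD[OF le]) (use assms in \<open>eventually_elim, use \<xi> in blast\<close>)
  qed
qed

locale scholtes_sequence = scholtes_limit f F1 F2 sequentially t x \<eta> \<nu>1 \<nu>2 xb \<sigma>1 \<sigma>2 \<rho>1 \<rho>2
  for f :: "real ^ 'n \<Rightarrow> real" and F1 F2 :: "real ^ 'n \<Rightarrow> real ^ 'k" and t x \<eta> \<nu>1 \<nu>2 xb \<sigma>1 \<sigma>2 \<rho>1 \<rho>2 +
  fixes q :: nat
  assumes index: "num_neg_eigenvalues (HS i) (TS i) = q"
    and NDC3: "restr_nonsingular HM TM"
begin

lemma sub_limit:
  assumes "G \<le> sequentially"
  shows "scholtes_limit f F1 F2 G t x \<eta> \<nu>1 \<nu>2 xb \<sigma>1 \<sigma>2 \<rho>1 \<rho>2"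
  by (rule scholtes_limit.intro)
    (fact f F1 F2 t_pos KKT C_stat LICQ rho_pos tendsto_mono[OF assms x_lim])+

lemma direction_limit:
  assumes "eventually (\<lambda>i. \<exists>\<xi>\<in>TS i. norm \<xi> = 1 \<and> (\<forall>j\<in>A01. w1 i j \<bullet> \<xi> = 0) \<and> (\<forall>j\<in>A10. w2 i j \<bullet> \<xi> = 0)
    \<and> Q i \<xi>) sequentially"
  obtains \<xi> z G where "norm z = 1" "eventually (\<lambda>i. Q i (\<xi> i)) G"
    "scholtes_direction_limit f F1 F2 G t x \<eta> \<nu>1 \<nu>2 xb \<sigma>1 \<sigma>2 \<rho>1 \<rho>2 \<xi> z"
proof -
  have "eventually (\<lambda>i. \<exists>\<xi>. norm \<xi> = 1 \<and> (\<xi> \<in> TS i \<and> (\<forall>j\<in>A01. w1 i j \<bullet> \<xi> = 0)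
      \<and> (\<forall>j\<in>A10. w2 i j \<bullet> \<xi> = 0) \<and> Q i \<xi>)) sequentially"
    using assms by eventually_elim blast
  then obtain \<xi> z G where G: "G \<noteq> bot" "G \<le> sequentially" "(\<xi> \<longlongrightarrow> z) G" "norm z = 1"
    and ev: "eventually (\<lambda>i. \<xi> i \<in> TS i \<and> (\<forall>j\<in>A01. w1 i j \<bullet> \<xi> i = 0)
      \<and> (\<forall>j\<in>A10. w2 i j \<bullet> \<xi> i = 0) \<and> Q i (\<xi> i)) G"
    by (rule unit_sequence_subfilter)
  show thesis
  proof
    show "norm z = 1" by (rule G)
    show "eventually (\<lambda>i. Q i (\<xi> i)) G" using ev by (simp add: eventually_conj_iff)
    show "scholtes_direction_limit f F1 F2 G t x \<eta> \<nu>1 \<nu>2 xb \<sigma>1 \<sigma>2 \<rho>1 \<rho>2 \<xi> z"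
      using G ev
      by (intro scholtes_direction_limit.intro scholtes_direction_limit_axioms.intro sub_limit)
        (simp_all add: eventually_conj_iff)
  qed
qed

text \<open>Count the conditions that make a direction critical, orthogonal to the \<open>q\<close> negative eigenvectors of
  the Scholtes form and orthogonal to the nonnegative eigenvectors of the limiting form. If \<open>q\<close> were
  smaller than the C-index, they would be fewer than the dimension of the whole space.\<close>
lemma C_index_le: "num_neg_eigenvalues HM TM + card A00neg \<le> q"
proof (rule ccontr)
  assume "\<not> ?thesis"
  then have less: "q < num_neg_eigenvalues HM TM + card A00neg" by simp
  obtain N P where "index_split HM TM N P"
    using index_split_exists[OF HM_sym subspace_TM] by blast
  then have NP: "finite P" "card N = num_neg_eigenvalues HM TM" "card N + card P = dim TM"
    "\<forall>\<xi>\<in>TM. (\<forall>b\<in>P. b \<bullet> \<xi> = 0) \<longrightarrow> \<xi> \<noteq> 0 \<longrightarrow> (HM *v \<xi>) \<bullet> \<xi> < 0"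
    unfolding index_split_def by blast+
  have "eventually (\<lambda>i. \<exists>\<xi>\<in>TS i. norm \<xi> = 1 \<and> (\<forall>j\<in>A01. w1 i j \<bullet> \<xi> = 0)
    \<and> (\<forall>j\<in>A10. w2 i j \<bullet> \<xi> = 0) \<and> (0 \<le> (HS i *v \<xi>) \<bullet> \<xi> \<and> (\<forall>b\<in>P. b \<bullet> \<xi> = 0))) sequentially"
    using settled_ev
  proof eventually_elim
    case (elim i)
    obtain N' P' where "index_split (HS i) (TS i) N' P'"
      using index_split_exists[OF HS_sym subspace_TS] by blast
    then have N': "finite N'" "card N' = q"
      "\<forall>\<xi>\<in>TS i. (\<forall>b\<in>N'. b \<bullet> \<xi> = 0) \<longrightarrow> 0 \<le> (HS i *v \<xi>) \<bullet> \<xi>"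
      unfolding index_split_def index by blast+
    have "card (N' \<union> P) + card A01 + card A10 + 2 * card A00 < CARD('n) + card A00neg"
      using card_Un_le[of N' P] N'(2) NP(2,3) less dim_TM by linarith
    moreover have "finite (N' \<union> P)" using N'(1) NP(1) by simp
    ultimately obtain \<xi> where \<xi>: "\<xi> \<in> TS i" "norm \<xi> = 1" "\<forall>j\<in>A01. w1 i j \<bullet> \<xi> = 0"
      "\<forall>j\<in>A10. w2 i j \<bullet> \<xi> = 0" "\<forall>v\<in>N' \<union> P. v \<bullet> \<xi> = 0"
      using critical_direction_of_codim[OF elim, of "N' \<union> P"] by blast
    then have "0 \<le> (HS i *v \<xi>) \<bullet> \<xi>" using N'(3) by blast
    with \<xi> show ?case by blast
  qed
  then obtain \<xi> z G where z: "norm z = 1"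
    and ev: "eventually (\<lambda>i. 0 \<le> (HS i *v \<xi> i) \<bullet> \<xi> i \<and> (\<forall>b\<in>P. b \<bullet> \<xi> i = 0)) G"
    and dir: "scholtes_direction_limit f F1 F2 G t x \<eta> \<nu>1 \<nu>2 xb \<sigma>1 \<sigma>2 \<rho>1 \<rho>2 \<xi> z"
    by (rule direction_limit)
  interpret D: scholtes_direction_limit f F1 F2 G t x \<eta> \<nu>1 \<nu>2 xb \<sigma>1 \<sigma>2 \<rho>1 \<rho>2 \<xi> z by (rule dir)
  have "eventually (\<lambda>i. 0 \<le> (HS i *v \<xi> i) \<bullet> \<xi> i) G"
    using ev by (simp add: eventually_conj_iff)
  note lim = D.nonneg_direction_limit[OF this]
  have "b \<bullet> z = 0" if "b \<in> P" for b
  proof (rule tendsto_unique[OF D.nontriv tendsto_inner[OF tendsto_const D.\<xi>_lim]])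
    show "((\<lambda>i. b \<bullet> \<xi> i) \<longlongrightarrow> 0) G"
      by (rule tendsto_eventually) (use ev in \<open>eventually_elim, use that in blast\<close>)
  qed
  then show False
    using NP(4) lim z by force
qed

text \<open>In the \<open>q\<close>-dimensional space of negative directions of the Scholtes form, impose one condition for
  each possibly inactive index, one for each negative biactive index, and orthogonality to the
  negative eigenvectors of the limiting form. If \<open>q\<close> exceeded the bound, a direction would remain.\<close>
lemma le_C_index:
  "q \<le> num_neg_eigenvalues HM TM + card A00neg + card {j \<in> A01. \<sigma>1 j = 0} + card {j \<in> A10. \<sigma>2 j = 0}"
proof (rule ccontr)
  assume "\<not> ?thesis"
  then have less: "num_neg_eigenvalues HM TM + card A00neg + card {j \<in> A01. \<sigma>1 j = 0}
    + card {j \<in> A10. \<sigma>2 j = 0} < q" by simp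
  obtain N P where "index_split HM TM N P"
    using index_split_exists[OF HM_sym subspace_TM] by blast
  then have N: "finite N" "card N = num_neg_eigenvalues HM TM"
    "\<forall>\<xi>\<in>TM. (\<forall>b\<in>N. b \<bullet> \<xi> = 0) \<longrightarrow> \<xi> \<noteq> 0 \<longrightarrow> 0 < (HM *v \<xi>) \<bullet> \<xi>"
    using NDC3 unfolding index_split_def by blast+
  have "eventually (\<lambda>i. \<exists>\<xi>\<in>TS i. norm \<xi> = 1 \<and> (\<forall>j\<in>A01. w1 i j \<bullet> \<xi> = 0)
    \<and> (\<forall>j\<in>A10. w2 i j \<bullet> \<xi> = 0) \<and> ((HS i *v \<xi>) \<bullet> \<xi> \<le> 0 \<and> (\<forall>b\<in>N. b \<bullet> \<xi> = 0)
      \<and> (\<forall>j\<in>A00neg. Dcomp F2 j (x i) \<bullet> \<xi> = 0))) sequentially"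
    using settled_ev
  proof eventually_elim
    case (elim i)
    obtain N' P' where "index_split (HS i) (TS i) N' P'"
      using index_split_exists[OF HS_sym subspace_TS] by blast
    then have P': "finite P'" "card N' = q" "card N' + card P' = dim (TS i)"
      "\<forall>\<xi>\<in>TS i. (\<forall>b\<in>P'. b \<bullet> \<xi> = 0) \<longrightarrow> \<xi> \<noteq> 0 \<longrightarrow> (HS i *v \<xi>) \<bullet> \<xi> < 0"
      unfolding index_split_def index by blast+
    have "card (N \<union> P') + card {j \<in> A01. \<sigma>1 j = 0} + card {j \<in> A10. \<sigma>2 j = 0} + card A00neg < dim (TS i)"
      using card_Un_le[of N P'] P'(2,3) N(2) less by linarith
    moreover have "finite (N \<union> P')" using P'(1) N(1) by simp
    ultimately obtain \<xi> where \<xi>: "\<xi> \<in> TS i" "norm \<xi> = 1" "\<forall>j\<in>A01. w1 i j \<bullet> \<xi> = 0"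
      "\<forall>j\<in>A10. w2 i j \<bullet> \<xi> = 0" "\<forall>v\<in>N \<union> P'. v \<bullet> \<xi> = 0" "\<forall>j\<in>A00neg. Dcomp F2 j (x i) \<bullet> \<xi> = 0"
      using critical_direction_in_tangent[OF elim, of "N \<union> P'"] by blast
    then have "(HS i *v \<xi>) \<bullet> \<xi> \<le> 0"
      using P'(4) by force
    with \<xi> show ?case by blast
  qed
  then obtain \<xi> z G where z: "norm z = 1"
    and ev: "eventually (\<lambda>i. (HS i *v \<xi> i) \<bullet> \<xi> i \<le> 0 \<and> (\<forall>b\<in>N. b \<bullet> \<xi> i = 0)
      \<and> (\<forall>j\<in>A00neg. Dcomp F2 j (x i) \<bullet> \<xi> i = 0)) G"
    and dir: "scholtes_direction_limit f F1 F2 G t x \<eta> \<nu>1 \<nu>2 xb \<sigma>1 \<sigma>2 \<rho>1 \<rho>2 \<xi> z"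
    by (rule direction_limit)
  interpret D: scholtes_direction_limit f F1 F2 G t x \<eta> \<nu>1 \<nu>2 xb \<sigma>1 \<sigma>2 \<rho>1 \<rho>2 \<xi> z by (rule dir)
  have "eventually (\<lambda>i. (HS i *v \<xi> i) \<bullet> \<xi> i \<le> 0) G"
    "eventually (\<lambda>i. \<forall>j\<in>A00neg. Dcomp F2 j (x i) \<bullet> \<xi> i = 0) G"
    using ev by (simp_all add: eventually_conj_iff)
  note lim = D.nonpos_direction_limit[OF this]
  have "b \<bullet> z = 0" if "b \<in> N" for b
  proof (rule tendsto_unique[OF D.nontriv tendsto_inner[OF tendsto_const D.\<xi>_lim]])
    show "((\<lambda>i. b \<bullet> \<xi> i) \<longlongrightarrow> 0) G"
      by (rule tendsto_eventually) (use ev in \<open>eventually_elim, use that in blast\<close>)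
  qed
  then show False
    using N(3) lim z by force
qed

end

theorem theorem1:
  fixes f :: "real ^ 'n \<Rightarrow> real"
    and F1 F2 :: "real ^ 'n \<Rightarrow> real ^ 'k"
    and t :: "nat \<Rightarrow> real"
    and x :: "nat \<Rightarrow> real ^ 'n"
    and \<eta> \<nu>1 \<nu>2 :: "nat \<Rightarrow> 'k \<Rightarrow> real"
    and xb :: "real ^ 'n"
    and \<sigma>1 \<sigma>2 \<rho>1 \<rho>2 :: "'k \<Rightarrow> real"
    and q :: nat
  assumes "C2 f" "C2_vec F1" "C2_vec F2"
    and "\<And>i. t i > 0" and "t \<longlonglongrightarrow> 0"
    and "\<And>i. nondegenerate_KKT_Scholtes f F1 F2 (t i) (x i) (\<eta> i) (\<nu>1 i) (\<nu>2 i)"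
    and "\<And>i. QI_Scholtes f F1 F2 (t i) (x i) (\<eta> i) (\<nu>1 i) (\<nu>2 i) = q"
    and "x \<longlonglongrightarrow> xb"
    and "nondegenerate_C_stationary f F1 F2 xb \<sigma>1 \<sigma>2 \<rho>1 \<rho>2"
  shows "max (int q - int (card {j \<in> a01 F1 F2 xb. \<sigma>1 j = 0})
                    - int (card {j \<in> a10 F1 F2 xb. \<sigma>2 j = 0})) 0
           \<le> int (C_index f F1 F2 xb \<sigma>1 \<sigma>2 \<rho>1 \<rho>2)
         \<and> C_index f F1 F2 xb \<sigma>1 \<sigma>2 \<rho>1 \<rho>2 \<le> q
         \<and> (NDC4 F1 F2 xb \<sigma>1 \<sigma>2 \<longrightarrow> C_index f F1 F2 xb \<sigma>1 \<sigma>2 \<rho>1 \<rho>2 = q)"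
proof -
  interpret scholtes_sequence f F1 F2 t x \<eta> \<nu>1 \<nu>2 xb \<sigma>1 \<sigma>2 \<rho>1 \<rho>2 q
    by unfold_locales
      (use assms in \<open>auto simp: nondegenerate_KKT_Scholtes_def nondegenerate_C_stationary_def
        QI_Scholtes_def\<close>)
  let ?CI = "C_index f F1 F2 xb \<sigma>1 \<sigma>2 \<rho>1 \<rho>2"
  have CI: "?CI = num_neg_eigenvalues HM TM + card A00neg"
    by (simp add: C_index_def QI_MPCC_def BI_MPCC_def)
  have lower: "?CI \<le> q"
    unfolding CI by (rule C_index_le)
  have upper: "q \<le> ?CI + card {j \<in> A01. \<sigma>1 j = 0} + card {j \<in> A10. \<sigma>2 j = 0}"
    unfolding CI by (rule le_C_index)
  have "?CI = q" if "NDC4 F1 F2 xb \<sigma>1 \<sigma>2"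
  proof -
    have "{j \<in> A01. \<sigma>1 j = 0} = {}" "{j \<in> A10. \<sigma>2 j = 0} = {}"
      using that by (auto simp: NDC4_def)
    then show ?thesis using lower upper by (simp only: card.empty)
  qed
  then show ?thesis using lower upper by auto
qed

end
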